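(* Assume (HY), (HV) and (H$\mathcal U$) as stated in the context, and suppose that the triangular array $(\zeta_n^k)$ satisfies $T_n^n\to T\in(0,\infty)$ in probability. (i) Assume that, for all $\nu\in\mathcal U(\mathbb F)$, the map $t>0\mapsto\mathbb E[Y^\nu(t)]$ is continuous at $t=T$. Then $\liminf_{n\to\infty}\mathbb E[Y^\nu(T_n^n)]\ge\mathbb E[Y^\nu(T)]$ for all $\nu\in\mathcal U(\mathbb F)$. (ii) Assume that the map $t>0\mapsto\sup_{\nu\in\mathcal U(\mathbb F)}\mathbb E[Y^\nu(t)]$ is continuous at $t=T$. Then $$\limsup_{n\to\infty}\int\sup_{\nu\in\mathcal U(\mathbb F)}\mathbb E[Y^\nu(z^1+\cdots+z^n)]\,m_n(dz)\le\sup_{\nu\in\mathcal U(\mathbb F)}\mathbb E[Y^\nu(T)].$$ (iii) Assume that for all $\nu\in\mathcal U(\mathbb F)$ the map $t>0\mapsto\mathbb E[Y^\nu(t)]$ is continuous at $t=T$, and that the map $t>0\mapsto\sup_{\nu\in\mathcal U(\mathbb F)}\mathbb E[Y^\nu(t)]$ is continuous at $t=T$. Then $$\lim_{n\to\infty}V_n^n(0)=\sup_{\nu\in\mathcal U(\mathbb F)}\mathbb E[Y^\nu(T)].$$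
   Context: Let $(\Omega,\mathcal A,\mathbb P)$ be a probability space with a filtration $\mathbb F=\{\mathcal F_t\}_{t\ge0}$ satisfying the usual conditions, with $\mathcal F_0$ trivial ($\mathcal A$ may be larger than $\mathcal F_\infty$). Controls: given a set $U$ of deterministic functions from $\mathbb R_+$ to $\mathbb R^d$, $d\ge1$, $\tilde{\mathcal U}(\mathbb F)$ is the collection of all $\mathbb F$-adapted processes $\nu$ such that $t\mapsto\nu(t,\omega)$ belongs to $U$ for almost every $\omega$. The controlled state process is given by a map $\nu\in\tilde{\mathcal U}(\mathbb F)\mapsto Y^\nu\in L^0_{\mathbb F}(\mathbb R_+\times\Omega,\mathbb R)$ (the set of real-valued $\mathbb F$-progressively measurable processes), where $Y^\nu(0)=Y(0)$ does not depend on $\nu$. The set of admissible controls $\mathcal U(\mathbb F)$ is a subset of $\tilde{\mathcal U}(\mathbb F)$. For $t\ge0$ and $\nu\in\mathcal U(\mathbb F)$, $\mathcal U(\mathbb F;t,\nu):=\{\mu\in\mathcal U(\mathbb F):\mu=\nu\text{ on }[0,t)\ \mathbb P\text{-a.s.}\}$. (H$\mathcal U$): for all $\nu_1,\nu_2\in\mathcal U(\mathbb F)$, $t\ge0$ and $A\in\mathcal F_t$, if $\nu_1=\nu_2$ on $[0,t)$ $\mathbb P$-a.s., then $\nu_1\mathbf 1_A+\nu_2\mathbf 1_{A^c}\in\mathcal U(\mathbb F)$. Randomized maturities: $\mathcal I^{\mathbb F}$ is the collection of all nonnegative random variables on $(\Omega,\mathcal A,\mathbb P)$ which are independent of $\mathcal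 F_\infty$. For each $n\ge1$, $(\zeta_n^k)_{1\le k\le n}$ is a sequence of independent random variables in $\mathcal I^{\mathbb F}$, $T_n^n:=\sum_{j=1}^n\zeta_n^j$, and $m_n$ is the law of $(\zeta_n^1,\dots,\zeta_n^n)$; $z=(z^1,\dots,z^n)$. Algorithm: for each $n$ and $\nu\in\mathcal U(\mathbb F)$, $V_0^{\nu,n}:=Y^\nu$, and for $k=0,\dots,n-1$, $$V_{k+1}^{\nu,n}(t):=\operatorname*{ess\,sup}_{\mu\in\mathcal U(\mathbb F;t,\nu)}\mathbb E[\bar V_k^{\mu,n}(t+\zeta_n^{n-k})\mid\mathcal F_t],\qquad t\ge0,$$ where $\bar V_0^{\mu,n}=V_0^{\mu,n}$ and, for $k\ge1$, $\bar V_k^{\mu,n}$ is the aggregating process of (HV). The value $V_n^{\nu,n}(0)$ does not depend on $\nu$ and is denoted $V_n^n(0)$. (HY): there is a uniformly integrable martingale $M^Y$ such that, for each $\nu\in\mathcal U(\mathbb F)$, $|Y^\nu(t)|\le M^Y(t)$ for all $t\ge0$, $\mathbb P$-a.s. (HV): for each $n$, each $\nu\in\mathcal U(\mathbb F)$ and $1\le k\le n-1$ there is a process $\bar V_k^{\nu,n}:\Omega\times\mathbb R_+\to\mathbb R$, measurable with respect to $\mathcal F_\infty\otimes\mathcal B_{\mathbb R_+}$, such that $\bar V_k^{\nu,n}(t)=V_k^{\nu,n}(t)$ $\mathbb P$-a.s. for all $t\ge0$.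
   Formalization: (i) also assumes each T_n^n is independent of F_∞; (iii) also assumes that if ν1=ν2 on [0,t) and A∈F_t, the state of ν1 1_A+ν2 1_{A^c} at every s≥t is a.s. Y^{ν1}(s) on A and Y^{ν2}(s) off A. Both fail without these. The integral in (ii) is an upper integral. *)

theory Defs
  imports "HOL-Probability.Probability"
begin

text \<open>
  Time is \<^typ>\<open>real\<close>, and only times \<open>t \<ge> 0\<close> carry meaning: every condition below is restricted
  to them, except that the library's \<^locale>\<open>filtration\<close> also asks for (irrelevant) sub-sigma-algebras
  \<open>F t\<close> at \<open>t < 0\<close>.  A process is a function \<open>X t \<omega>\<close> of time and outcome.  As always in the library
  when a measure plays the role of a sigma-algebra, only \<open>space (F t)\<close> and \<open>sets (F t)\<close> matter.
\<close>

type_synonym ('a, 'd) control = "real \<Rightarrow> 'a \<Rightarrow> real ^ 'd"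

section \<open>Filtration\<close>

definition F_infinity :: "'a measure \<Rightarrow> (real \<Rightarrow> 'a measure) \<Rightarrow> 'a measure" where
  "F_infinity M F = sigma (space M) (\<Union>t\<in>{0..}. sets (F t))"

definition usual_conditions :: "'a measure \<Rightarrow> (real \<Rightarrow> 'a measure) \<Rightarrow> bool" where
  "usual_conditions M F \<longleftrightarrow>
     (\<forall>t\<ge>0. (\<Inter>s\<in>{t<..}. sets (F s)) = sets (F t)) \<and>
     (\<forall>N\<in>null_sets M. \<forall>S\<subseteq>N. S \<in> sets (F 0))"

definition trivial_at_0 :: "'a measure \<Rightarrow> (real \<Rightarrow> 'a measure) \<Rightarrow> bool" where
  "trivial_at_0 M F \<longleftrightarrow> (\<forall>A\<in>sets (F 0). measure M A = 0 \<or> measure M A = 1)"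

definition progressively_measurable ::
    "(real \<Rightarrow> 'a measure) \<Rightarrow> (real \<Rightarrow> 'a \<Rightarrow> real) \<Rightarrow> bool" where
  "progressively_measurable F X \<longleftrightarrow>
     (\<forall>t\<ge>0. (\<lambda>(s, \<omega>). X s \<omega>) \<in> borel_measurable (restrict_space borel {0..t} \<Otimes>\<^sub>M F t))"

definition martingale_on :: "'a measure \<Rightarrow> (real \<Rightarrow> 'a measure) \<Rightarrow> (real \<Rightarrow> 'a \<Rightarrow> real) \<Rightarrow> bool" where
  "martingale_on M F X \<longleftrightarrow>
     (\<forall>t\<ge>0. X t \<in> borel_measurable (F t) \<and> integrable M (X t)) \<and>
     (\<forall>s t. 0 \<le> s \<longrightarrow> s \<le> t \<longrightarrow> (AE \<omega> in M. real_cond_exp M (F s) (X t) \<omega> = X s \<omega>))"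

definition uniformly_integrable :: "'a measure \<Rightarrow> (real \<Rightarrow> 'a \<Rightarrow> real) \<Rightarrow> bool" where
  "uniformly_integrable M X \<longleftrightarrow>
     (\<forall>t\<ge>0. integrable M (X t)) \<and>
     (\<forall>\<epsilon>>0. \<exists>c. \<forall>t\<ge>0. (\<integral>\<omega>. \<bar>X t \<omega>\<bar> * indicator {\<omega>. c < \<bar>X t \<omega>\<bar>} \<omega> \<partial>M) \<le> \<epsilon>)"

section \<open>Controls\<close>

text \<open>
  \<open>U\<close> consists of functions on \<open>{0..}\<close>, encoded as extensional functions on \<^typ>\<open>real\<close>; hence the
  restriction of the paths of \<open>\<nu>\<close>.
\<close>

definition controls ::
    "'a measure \<Rightarrow> (real \<Rightarrow> 'a measure) \<Rightarrow> (real \<Rightarrow> real ^ 'd) set \<Rightarrow> ('a, 'd::finite) control set" where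
  "controls M F U =
     {\<nu>. (\<forall>t\<ge>0. \<nu> t \<in> borel_measurable (F t)) \<and> (AE \<omega> in M. (\<lambda>t\<in>{0..}. \<nu> t \<omega>) \<in> U)}"

definition agree_before :: "'a measure \<Rightarrow> real \<Rightarrow> ('a, 'd::finite) control \<Rightarrow> ('a, 'd) control \<Rightarrow> bool" where
  "agree_before M t \<mu> \<nu> \<longleftrightarrow> (AE \<omega> in M. \<forall>s\<in>{0..<t}. \<mu> s \<omega> = \<nu> s \<omega>)"

definition admissible_from ::
    "'a measure \<Rightarrow> ('a, 'd::finite) control set \<Rightarrow> real \<Rightarrow> ('a, 'd) control \<Rightarrow> ('a, 'd) control set" where
  "admissible_from M Adm t \<nu> = {\<mu> \<in> Adm. agree_before M t \<mu> \<nu>}"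

text \<open>\<open>paste A \<nu>\<^sub>1 \<nu>\<^sub>2\<close> is \<open>\<nu>\<^sub>1 1\<^sub>A + \<nu>\<^sub>2 1\<^sub>B\<close>, with \<open>B\<close> the complement of \<open>A\<close>.\<close>

definition paste :: "'a set \<Rightarrow> ('a, 'd::finite) control \<Rightarrow> ('a, 'd) control \<Rightarrow> ('a, 'd) control" where
  "paste A \<nu>\<^sub>1 \<nu>\<^sub>2 = (\<lambda>t \<omega>. if \<omega> \<in> A then \<nu>\<^sub>1 t \<omega> else \<nu>\<^sub>2 t \<omega>)"

definition controlled_state ::
    "'a measure \<Rightarrow> (real \<Rightarrow> 'a measure) \<Rightarrow> ('a, 'd::finite) control set \<Rightarrow>
     (('a, 'd) control \<Rightarrow> real \<Rightarrow> 'a \<Rightarrow> real) \<Rightarrow> bool" where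
  "controlled_state M F C Y \<longleftrightarrow>
     (\<forall>\<nu>\<in>C. progressively_measurable F (Y \<nu>)) \<and>
     (\<forall>\<nu>\<in>C. \<forall>\<mu>\<in>C. AE \<omega> in M. Y \<nu> 0 \<omega> = Y \<mu> 0 \<omega>)"

definition HU :: "'a measure \<Rightarrow> (real \<Rightarrow> 'a measure) \<Rightarrow> ('a, 'd::finite) control set \<Rightarrow> bool" where
  "HU M F Adm \<longleftrightarrow>
     (\<forall>\<nu>\<^sub>1\<in>Adm. \<forall>\<nu>\<^sub>2\<in>Adm. \<forall>t\<ge>0. \<forall>A\<in>sets (F t).
        agree_before M t \<nu>\<^sub>1 \<nu>\<^sub>2 \<longrightarrow> paste A \<nu>\<^sub>1 \<nu>\<^sub>2 \<in> Adm)"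

text \<open>
  The scenario-wise dependence of the state on the control that gives (HU) its use: under a pasted
  control the state follows, after the pasting time, the state of whichever control is in force.
  It makes the families under the essential suprema below directed upwards; an arbitrary map
  \<open>\<nu> \<mapsto> Y \<nu>\<close> need not have it, and the convergence of the algorithm then fails.
\<close>

definition state_respects_pasting ::
    "'a measure \<Rightarrow> (real \<Rightarrow> 'a measure) \<Rightarrow> ('a, 'd::finite) control set \<Rightarrow>
     (('a, 'd) control \<Rightarrow> real \<Rightarrow> 'a \<Rightarrow> real) \<Rightarrow> bool" where
  "state_respects_pasting M F Adm Y \<longleftrightarrow>
     (\<forall>\<nu>\<^sub>1\<in>Adm. \<forall>\<nu>\<^sub>2\<in>Adm. \<forall>t\<ge>0. \<forall>A\<in>sets (F t).
        agree_before M t \<nu>\<^sub>1 \<nu>\<^sub>2 \<longrightarrow>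
        (\<forall>s\<ge>t. AE \<omega> in M.
           Y (paste A \<nu>\<^sub>1 \<nu>\<^sub>2) s \<omega> = (if \<omega> \<in> A then Y \<nu>\<^sub>1 s \<omega> else Y \<nu>\<^sub>2 s \<omega>)))"

definition HY ::
    "'a measure \<Rightarrow> (real \<Rightarrow> 'a measure) \<Rightarrow> ('a, 'd::finite) control set \<Rightarrow>
     (('a, 'd) control \<Rightarrow> real \<Rightarrow> 'a \<Rightarrow> real) \<Rightarrow> bool" where
  "HY M F Adm Y \<longleftrightarrow>
     (\<exists>MY. martingale_on M F MY \<and> uniformly_integrable M MY \<and>
        (\<forall>\<nu>\<in>Adm. AE \<omega> in M. \<forall>t\<ge>0. \<bar>Y \<nu> t \<omega>\<bar> \<le> MY t \<omega>))"

section \<open>Randomized maturities\<close>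

definition randomized_maturities :: "'a measure \<Rightarrow> (real \<Rightarrow> 'a measure) \<Rightarrow> ('a \<Rightarrow> real) set" where
  "randomized_maturities M F =
     {\<zeta> \<in> borel_measurable M. (\<forall>\<omega>\<in>space M. 0 \<le> \<zeta> \<omega>) \<and>
        prob_space.indep_set M (sets (F_infinity M F)) {\<zeta> -` B \<inter> space M | B. B \<in> sets borel}}"

definition total_maturity :: "(nat \<Rightarrow> nat \<Rightarrow> 'a \<Rightarrow> real) \<Rightarrow> nat \<Rightarrow> 'a \<Rightarrow> real" where
  "total_maturity \<zeta> n \<omega> = (\<Sum>k=1..n. \<zeta> n k \<omega>)"

definition maturity_law :: "'a measure \<Rightarrow> (nat \<Rightarrow> nat \<Rightarrow> 'a \<Rightarrow> real) \<Rightarrow> nat \<Rightarrow> (nat \<Rightarrow> real) measure" where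
  "maturity_law M \<zeta> n = distr M (\<Pi>\<^sub>M k\<in>{1..n}. borel) (\<lambda>\<omega>. \<lambda>k\<in>{1..n}. \<zeta> n k \<omega>)"

definition converges_in_probability :: "'a measure \<Rightarrow> (nat \<Rightarrow> 'a \<Rightarrow> real) \<Rightarrow> real \<Rightarrow> bool" where
  "converges_in_probability M X c \<longleftrightarrow>
     (\<forall>\<epsilon>>0. (\<lambda>n. measure M {\<omega> \<in> space M. \<epsilon> < \<bar>X n \<omega> - c\<bar>}) \<longlonglongrightarrow> 0)"

section \<open>The algorithm\<close>

definition is_ess_sup :: "'a measure \<Rightarrow> ('a \<Rightarrow> real) set \<Rightarrow> ('a \<Rightarrow> real) \<Rightarrow> bool" where
  "is_ess_sup M XX S \<longleftrightarrow>
     S \<in> borel_measurable M \<and> (\<forall>X\<in>XX. AE \<omega> in M. X \<omega> \<le> S \<omega>) \<and>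
     (\<forall>Z\<in>borel_measurable M. (\<forall>X\<in>XX. AE \<omega> in M. X \<omega> \<le> Z \<omega>) \<longrightarrow> (AE \<omega> in M. S \<omega> \<le> Z \<omega>))"

text \<open>
  \<open>V n k \<nu>\<close> is the \<open>k\<close>-th iterate for the \<open>n\<close>-th row of the array, \<open>Vbar n k \<nu>\<close> its aggregating
  process.  Essential suprema and conditional expectations being unique only almost surely, the
  recursion is a relation satisfied by every choice of versions.
\<close>

definition algorithm ::
    "'a measure \<Rightarrow> (real \<Rightarrow> 'a measure) \<Rightarrow> ('a, 'd::finite) control set \<Rightarrow>
     (('a, 'd) control \<Rightarrow> real \<Rightarrow> 'a \<Rightarrow> real) \<Rightarrow> (nat \<Rightarrow> nat \<Rightarrow> 'a \<Rightarrow> real) \<Rightarrow>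
     (nat \<Rightarrow> nat \<Rightarrow> ('a, 'd) control \<Rightarrow> real \<Rightarrow> 'a \<Rightarrow> real) \<Rightarrow>
     (nat \<Rightarrow> nat \<Rightarrow> ('a, 'd) control \<Rightarrow> real \<Rightarrow> 'a \<Rightarrow> real) \<Rightarrow> bool" where
  "algorithm M F Adm Y \<zeta> V Vbar \<longleftrightarrow>
     (\<forall>n\<ge>1. \<forall>\<nu>\<in>Adm.
        V n 0 \<nu> = Y \<nu> \<and> Vbar n 0 \<nu> = V n 0 \<nu> \<and>
        (\<forall>k<n. \<forall>t\<ge>0. is_ess_sup M
           {real_cond_exp M (F t) (\<lambda>\<omega>. Vbar n k \<mu> (t + \<zeta> n (n - k) \<omega>) \<omega>) | \<mu>.
              \<mu> \<in> admissible_from M Adm t \<nu>}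
           (V n (Suc k) \<nu> t)))"

definition HV ::
    "'a measure \<Rightarrow> (real \<Rightarrow> 'a measure) \<Rightarrow> ('a, 'd::finite) control set \<Rightarrow>
     (nat \<Rightarrow> nat \<Rightarrow> ('a, 'd) control \<Rightarrow> real \<Rightarrow> 'a \<Rightarrow> real) \<Rightarrow>
     (nat \<Rightarrow> nat \<Rightarrow> ('a, 'd) control \<Rightarrow> real \<Rightarrow> 'a \<Rightarrow> real) \<Rightarrow> bool" where
  "HV M F Adm V Vbar \<longleftrightarrow>
     (\<forall>n\<ge>1. \<forall>\<nu>\<in>Adm. \<forall>k\<in>{1..n - 1}.
        (\<lambda>(\<omega>, t). Vbar n k \<nu> t \<omega>)
          \<in> borel_measurable (F_infinity M F \<Otimes>\<^sub>M restrict_space borel {0..}) \<and>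
        (\<forall>t\<ge>0. AE \<omega> in M. Vbar n k \<nu> t \<omega> = V n k \<nu> t \<omega>))"

section \<open>Integral of a possibly non-measurable supremum\<close>

text \<open>
  A supremum over an uncountable set of controls need not be a measurable function of time, whereas
  the Bochner integral of a non-measurable function is 0 by convention.  The upper integral agrees
  with the Bochner integral on integrable functions and needs no measurability.
\<close>

definition upper_integral :: "'a measure \<Rightarrow> ('a \<Rightarrow> real) \<Rightarrow> ereal" where
  "upper_integral N f =
     (INF g\<in>{g. integrable N g \<and> (AE x in N. f x \<le> g x)}. ereal (\<integral>x. g x \<partial>N))"

lemma upper_integral_eq_integral:
  assumes "integrable N f"
  shows "upper_integral N f = ereal (\<integral>x. f x \<partial>N)"
  unfolding upper_integral_def
proof (rule antisym)
  show "(INF g\<in>{g. integrable N g \<and> (AE x in N. f x \<le> g x)}. ereal (\<integral>x. g x \<partial>N)) \<le> ereal (\<integral>x. f x \<partial>N)"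
    using assms by (intro INF_lower2[of f]) auto
  show "ereal (\<integral>x. f x \<partial>N) \<le> (INF g\<in>{g. integrable N g \<and> (AE x in N. f x \<le> g x)}. ereal (\<integral>x. g x \<partial>N))"
    using assms by (intro INF_greatest) (auto intro: integral_mono_AE)
qed

end

theory Submission
  imports Defs
begin

text \<open>
  A maturity \<open>\<zeta>\<close> is independent of \<open>F\<^sub>\<infinity>\<close>, so for a jointly measurable
  process \<open>W\<close> and an event \<open>A\<close> of \<open>F\<^sub>t\<close> Fubini's theorem gives
  \<open>E[1\<^sub>A W(t + \<zeta>)] = \<integral> E[1\<^sub>A W(t + z)] P\<^sub>\<zeta>(dz)\<close> (\<open>maturity_integral\<close>).  Everything about the
  continuation value \<open>E[W(t + \<zeta>) | F\<^sub>t]\<close> is read off from this identity, where the time is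
  deterministic.  Testing on events of \<open>F\<^sub>t\<close>, the bound \<open>\<bar>W(u)\<bar> \<le> M\<^sup>Y(u)\<close>, known almost surely for each
  single \<open>u\<close>, passes to the continuation value through the martingale property at deterministic times, so
  that \<open>M\<^sup>Y\<close> is never evaluated at a random time (\<open>continuation_abs_le\<close>); and so do comparisons that
  hold on an event of \<open>F\<^sub>t\<close> (\<open>continuation_mono_on\<close>).  For \<open>A = \<Omega>\<close> the identity turns one
  step of the algorithm into one convolution of means.

  For the algorithm, an induction on \<open>k\<close> shows that the iterates dominate pasting: under a control
  pasted on \<open>A\<close> the iterate is at least the iterate of whichever control is in force
  (\<open>Vbar_le_paste\<close>).  Hence the continuation values competing in each essential supremum are directed
  upwards, and the expectation of that essential supremum is the supremum of their expectations.
  Therefore, if \<open>E[Y\<^sup>\<nu>(t)] \<le> h(t)\<close> for all \<open>\<nu>\<close> and \<open>t\<close>, then \<open>E[V\<^sub>k\<^sup>\<nu>(t)] \<le> E[h(t + S\<^sub>k)]\<close>, with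
  \<open>S\<^sub>k\<close> the sum of the last \<open>k\<close> maturities of the row (\<open>Vbar_integral_le_tail\<close>); keeping one control \<open>\<mu>\<close>
  throughout gives the reverse bound with \<open>h(t) = E[Y\<^sup>\<mu>(t)]\<close> (\<open>Vbar_integral_ge_tail\<close>).
  As \<open>F\<^sub>0\<close> is trivial, \<open>V\<^sub>n\<^sup>n(0)\<close> is a constant, and it is squeezed between \<open>E[\<phi>(T\<^sub>n)]\<close>, where \<open>T\<^sub>n\<close>
  is the total maturity and \<open>\<phi>(t) = E[Y\<^sup>\<mu>(t)]\<close> for any \<open>\<mu>\<close>, and \<open>E[h(T\<^sub>n)]\<close> for any majorant \<open>h\<close>.

  All three parts then rest on the convergence \<open>E[\<phi>(T\<^sub>n)] \<longlongrightarrow> \<phi>(T)\<close> for bounded Borel functions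
  \<open>\<phi>\<close> continuous at \<open>T\<close> (\<open>integral_tendsto_of_converges_in_probability\<close>).  The function
  \<open>g(t) = sup\<^sub>\<nu> E[Y\<^sup>\<nu>(t)]\<close> need not be Borel; it is replaced by step functions that lie above it, are
  constant near \<open>T\<close>, and have there a value as close to \<open>g(T)\<close> as desired (\<open>exists_step_majorant\<close>).
\<close>

section \<open>Convergence in probability, independent sums and majorants\<close>

text \<open>
  Outside an event of vanishing probability the argument is close to \<open>T\<close>, where continuity controls
  the integrand; on that event the bound \<open>C\<close> does.
\<close>

lemma (in prob_space) integral_tendsto_of_converges_in_probability:
  fixes \<phi> :: "real \<Rightarrow> real"
  assumes X: "\<And>n. X n \<in> borel_measurable M"
    and conv: "converges_in_probability M X T"
    and \<phi>: "\<phi> \<in> borel_measurable borel" "\<And>x. \<bar>\<phi> x\<bar> \<le> C" "isCont \<phi> T"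
  shows "(\<lambda>n. \<integral>\<omega>. \<phi> (X n \<omega>) \<partial>M) \<longlonglongrightarrow> \<phi> T"
proof (rule LIMSEQ_I)
  note [measurable] = X \<phi>(1)
  fix r :: real assume r: "0 < r"
  obtain d where d: "d > 0" "\<And>x. dist x T < d \<Longrightarrow> dist (\<phi> x) (\<phi> T) < r / 2"
    using \<phi>(3)[unfolded continuous_at_eps_delta, rule_format, of "r / 2"] r by auto
  have C: "0 \<le> C" using \<phi>(2)[of 0] by linarith
  let ?B = "\<lambda>n. {\<omega> \<in> space M. d / 2 < \<bar>X n \<omega> - T\<bar>}"
  have "(\<lambda>n. measure M (?B n)) \<longlonglongrightarrow> 0"
    using conv d(1) unfolding converges_in_probability_def by (elim allE[of _ "d / 2"]) simp
  \<comment> \<open>The summand 1 keeps the denominator positive when \<open>C = 0\<close>.\<close>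
  moreover have "0 < r / (4 * C + 1)" using r C by simp
  ultimately obtain N where N: "\<And>n. n \<ge> N \<Longrightarrow> norm (measure M (?B n) - 0) < r / (4 * C + 1)"
    by (rule LIMSEQ_D[THEN exE]) blast
  show "\<exists>no. \<forall>n\<ge>no. norm ((\<integral>\<omega>. \<phi> (X n \<omega>) \<partial>M) - \<phi> T) < r"
  proof (intro exI allI impI)
    fix n assume n: "n \<ge> N"
    have int: "integrable M (\<lambda>\<omega>. \<phi> (X n \<omega>))"
      by (rule integrable_const_bound[of _ C]) (use \<phi>(2) in auto)
    have "\<bar>(\<integral>\<omega>. \<phi> (X n \<omega>) \<partial>M) - \<phi> T\<bar> = \<bar>\<integral>\<omega>. \<phi> (X n \<omega>) - \<phi> T \<partial>M\<bar>"
      using int by (simp add: prob_space)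
    also have "\<dots> \<le> (\<integral>\<omega>. \<bar>\<phi> (X n \<omega>) - \<phi> T\<bar> \<partial>M)"
      by (rule integral_abs_bound)
    also have "\<dots> \<le> (\<integral>\<omega>. r / 2 + 2 * C * indicator (?B n) \<omega> \<partial>M)"
    proof (rule integral_mono)
      show "\<bar>\<phi> (X n \<omega>) - \<phi> T\<bar> \<le> r / 2 + 2 * C * indicator (?B n) \<omega>" if "\<omega> \<in> space M" for \<omega>
        using d(2)[of "X n \<omega>"] \<phi>(2)[of "X n \<omega>"] \<phi>(2)[of T] d(1) r that
        by (auto simp: indicator_def dist_real_def split: if_splits)
    qed (use int in \<open>auto intro!: integrable_real_indicator simp: emeasure_eq_measure\<close>)
    also have "\<dots> = r / 2 + 2 * C * measure M (?B n)"
      by (subst Bochner_Integration.integral_add)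
         (auto intro!: integrable_real_indicator simp: emeasure_eq_measure prob_space)
    also have "\<dots> < r"
    proof -
      have "2 * C * measure M (?B n) \<le> 2 * C * (r / (4 * C + 1))"
        using N[OF n] C by (intro mult_left_mono) auto
      also have "\<dots> < r / 2" using r C by (simp add: field_simps)
      finally show ?thesis by simp
    qed
    finally show "norm ((\<integral>\<omega>. \<phi> (X n \<omega>) \<partial>M) - \<phi> T) < r" by simp
  qed
qed

text \<open>
  Conditioning on the first summand.  The law of \<open>X\<close> is integrated in the form of a second copy of the
  probability space, so that the identity can be iterated without naming any law.
\<close>

lemma (in prob_space) integral_add_indep_var:
  fixes X Z :: "'a \<Rightarrow> real" and \<phi> :: "real \<Rightarrow> real"
  assumes ind: "indep_var borel X borel Z"
    and \<phi>[measurable]: "\<phi> \<in> borel_measurable borel" and bnd: "\<And>x. \<bar>\<phi> x\<bar> \<le> C"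
  shows "integrable M (\<lambda>\<omega>'. \<integral>\<omega>. \<phi> (X \<omega>' + Z \<omega>) \<partial>M)"
    and "(\<integral>\<omega>. \<phi> (X \<omega> + Z \<omega>) \<partial>M) = (\<integral>\<omega>'. \<integral>\<omega>. \<phi> (X \<omega>' + Z \<omega>) \<partial>M \<partial>M)"
proof -
  have [measurable]: "X \<in> borel_measurable M" "Z \<in> borel_measurable M"
    using indep_var_rv1[OF ind] indep_var_rv2[OF ind] by auto
  let ?DX = "distr M borel X" and ?DZ = "distr M borel Z"
  let ?f = "\<lambda>p. \<phi> (fst p + snd p)"
  interpret X: prob_space ?DX by (rule prob_space_distr) simp
  interpret Z: prob_space ?DZ by (rule prob_space_distr) simp
  interpret XZ: pair_prob_space ?DX ?DZ ..
  have f: "?f \<in> borel_measurable (borel \<Otimes>\<^sub>M borel)" by measurable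
  have eq: "?DX \<Otimes>\<^sub>M ?DZ = distr M (borel \<Otimes>\<^sub>M borel) (\<lambda>\<omega>. (X \<omega>, Z \<omega>))"
    using ind by (simp add: indep_var_distribution_eq)
  have int: "integrable (?DX \<Otimes>\<^sub>M ?DZ) ?f"
    by (rule XZ.integrable_const_bound[of _ C]) (use bnd f in auto)
  have inner: "(\<integral>z. \<phi> (x + z) \<partial>?DZ) = (\<integral>\<omega>. \<phi> (x + Z \<omega>) \<partial>M)" for x
    by (rule integral_distr) measurable
  have "integrable ?DX (\<lambda>x. \<integral>\<omega>. \<phi> (x + Z \<omega>) \<partial>M)"
    using XZ.integrable_fst'[OF int] by (simp add: inner)
  then show "integrable M (\<lambda>\<omega>'. \<integral>\<omega>. \<phi> (X \<omega>' + Z \<omega>) \<partial>M)"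
    by (rule integrable_distr[rotated]) simp
  have meas: "(\<lambda>x. \<integral>\<omega>. \<phi> (x + Z \<omega>) \<partial>M) \<in> borel_measurable borel" by measurable
  have "(\<integral>\<omega>. \<phi> (X \<omega> + Z \<omega>) \<partial>M) = integral\<^sup>L (?DX \<Otimes>\<^sub>M ?DZ) ?f"
    unfolding eq by (subst integral_distr[OF _ f]) simp_all
  also have "\<dots> = (\<integral>x. \<integral>\<omega>. \<phi> (x + Z \<omega>) \<partial>M \<partial>?DX)"
    using XZ.integral_fst'[OF int] by (simp add: inner)
  also have "\<dots> = (\<integral>\<omega>'. \<integral>\<omega>. \<phi> (X \<omega>' + Z \<omega>) \<partial>M \<partial>M)"
    by (rule integral_distr[OF _ meas]) simp
  finally show "(\<integral>\<omega>. \<phi> (X \<omega> + Z \<omega>) \<partial>M) = (\<integral>\<omega>'. \<integral>\<omega>. \<phi> (X \<omega>' + Z \<omega>) \<partial>M \<partial>M)" .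
qed

text \<open>
  The majorant is \<open>m\<close> near \<open>T\<close> and a global bound elsewhere; it is Borel whatever \<open>g\<close> is.
\<close>

lemma exists_step_majorant:
  fixes g :: "real \<Rightarrow> real"
  assumes cont: "continuous (at T within {0<..}) g" and T: "0 < T"
    and bnd: "\<And>t. 0 \<le> t \<Longrightarrow> \<bar>g t\<bar> \<le> C" and m: "g T < m"
  shows "\<exists>h D. h \<in> borel_measurable borel \<and> (\<forall>x. \<bar>h x\<bar> \<le> D) \<and> isCont h T \<and> h T = m \<and> (\<forall>t\<ge>0. g t \<le> h t)"
proof -
  have "isCont g T" using cont T by (simp add: at_within_open[of T "{0<..}"])
  then obtain d where d: "0 < d" "\<And>x. dist x T < d \<Longrightarrow> dist (g x) (g T) < m - g T"
    unfolding continuous_at_eps_delta using m by (metis diff_gt_0_iff_gt)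
  define h where "h = (\<lambda>t. if \<bar>t - T\<bar> < d then m else C)"
  have "h \<in> borel_measurable borel" unfolding h_def by measurable
  moreover have "\<bar>h x\<bar> \<le> \<bar>m\<bar> + \<bar>C\<bar>" for x by (simp add: h_def)
  moreover have "isCont h T"
  proof -
    have "eventually (\<lambda>t. t \<in> ball T d) (nhds T)" using d(1) by (intro eventually_nhds_in_open) auto
    then have "eventually (\<lambda>t. \<bar>t - T\<bar> < d) (nhds T)" by eventually_elim (simp add: dist_real_def)
    then have "eventually (\<lambda>t. h t = m) (nhds T)" by eventually_elim (simp add: h_def)
    then show ?thesis by (subst isCont_cong[where g = "\<lambda>_. m"]) auto
  qed
  moreover have "h T = m" using d(1) by (simp add: h_def)
  moreover have "g t \<le> h t" if t: "0 \<le> t" for t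
    using d(2)[of t] bnd[OF t] by (auto simp: h_def dist_real_def)
  ultimately show ?thesis by blast
qed

section \<open>Essential suprema\<close>

lemma is_ess_sup_upper: "is_ess_sup M XX S \<Longrightarrow> X \<in> XX \<Longrightarrow> AE \<omega> in M. X \<omega> \<le> S \<omega>"
  unfolding is_ess_sup_def by simp

lemma is_ess_sup_least:
  assumes "is_ess_sup M XX S" "Z \<in> borel_measurable M" "\<And>X. X \<in> XX \<Longrightarrow> AE \<omega> in M. X \<omega> \<le> Z \<omega>"
  shows "AE \<omega> in M. S \<omega> \<le> Z \<omega>"
  using assms unfolding is_ess_sup_def by simp

text \<open>
  The upper bound that equals \<open>S'\<close> on \<open>B\<close> and \<open>S\<close> elsewhere localises the minimality of \<open>S\<close> to
  the event \<open>B\<close>.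
\<close>

lemma ess_sup_le_on:
  assumes S: "is_ess_sup M XX S" and S': "is_ess_sup M XX' S'" and B: "B \<in> sets M"
    and le: "\<And>X. X \<in> XX \<Longrightarrow> \<exists>X'\<in>XX'. AE \<omega> in M. \<omega> \<in> B \<longrightarrow> X \<omega> \<le> X' \<omega>"
  shows "AE \<omega> in M. \<omega> \<in> B \<longrightarrow> S \<omega> \<le> S' \<omega>"
proof -
  have [measurable]: "S \<in> borel_measurable M" "S' \<in> borel_measurable M" "B \<in> sets M"
    using S S' B unfolding is_ess_sup_def by auto
  let ?Z = "\<lambda>\<omega>. if \<omega> \<in> B then S' \<omega> else S \<omega>"
  have Z: "?Z \<in> borel_measurable M" by measurable
  have "AE \<omega> in M. X \<omega> \<le> ?Z \<omega>" if X: "X \<in> XX" for X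
  proof -
    obtain X' where "X' \<in> XX'" and X': "AE \<omega> in M. \<omega> \<in> B \<longrightarrow> X \<omega> \<le> X' \<omega>" using le[OF X] by (rule bexE)
    then have "AE \<omega> in M. X' \<omega> \<le> S' \<omega>" using is_ess_sup_upper[OF S'] by simp
    with is_ess_sup_upper[OF S X] X' show ?thesis by eventually_elim auto
  qed
  then have "AE \<omega> in M. S \<omega> \<le> ?Z \<omega>" by (rule is_ess_sup_least[OF S Z])
  then show ?thesis by eventually_elim auto
qed

text \<open>
  By directedness some almost surely increasing sequence in \<open>XX\<close> has expectations tending to their
  supremum.  Its limit \<open>Z\<close> already has that expectation, so no element of \<open>XX\<close> can exceed \<open>Z\<close> on an
  event of positive probability: the expectation of the maximum would be too large.  Hence \<open>Z\<close> is the
  essential supremum.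
\<close>

lemma integral_ess_sup_le_of_directed:
  assumes S: "is_ess_sup M XX S" and ne: "XX \<noteq> {}"
    and int: "\<And>X. X \<in> XX \<Longrightarrow> integrable M X"
    and D: "integrable M D" "\<And>X. X \<in> XX \<Longrightarrow> AE \<omega> in M. \<bar>X \<omega>\<bar> \<le> D \<omega>"
    and dir: "\<And>X Y. X \<in> XX \<Longrightarrow> Y \<in> XX \<Longrightarrow> \<exists>Z\<in>XX. AE \<omega> in M. max (X \<omega>) (Y \<omega>) \<le> Z \<omega>"
    and le: "\<And>X. X \<in> XX \<Longrightarrow> (\<integral>\<omega>. X \<omega> \<partial>M) \<le> c"
  shows "(\<integral>\<omega>. S \<omega> \<partial>M) \<le> c"
proof -
  have Smeas[measurable]: "S \<in> borel_measurable M" using S by (simp add: is_ess_sup_def)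
  define s where "s = (SUP X\<in>XX. \<integral>\<omega>. X \<omega> \<partial>M)"
  have bdd: "bdd_above ((\<lambda>X. \<integral>\<omega>. X \<omega> \<partial>M) ` XX)" by (rule bdd_aboveI2[where M = c]) (rule le)
  have sc: "s \<le> c" unfolding s_def using ne le by (intro cSUP_least) auto
  have s_ub: "(\<integral>\<omega>. X \<omega> \<partial>M) \<le> s" if "X \<in> XX" for X
    unfolding s_def by (rule cSUP_upper[OF that bdd])
  have ex: "\<exists>X\<in>XX. s - e < (\<integral>\<omega>. X \<omega> \<partial>M)" if "e > 0" for e
    using less_cSUP_iff[OF ne bdd, of "s - e"] that unfolding s_def by auto
  have "\<exists>f. \<forall>n. (f n \<in> XX \<and> s - 1 / Suc n < (\<integral>\<omega>. f n \<omega> \<partial>M)) \<and> (AE \<omega> in M. f n \<omega> \<le> f (Suc n) \<omega>)"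
  proof (rule dependent_nat_choice)
    show "\<exists>x. x \<in> XX \<and> s - 1 / Suc 0 < (\<integral>\<omega>. x \<omega> \<partial>M)" using ex[of 1] by auto
  next
    fix x n assume x: "x \<in> XX \<and> s - 1 / Suc n < (\<integral>\<omega>. x \<omega> \<partial>M)"
    obtain y where y: "y \<in> XX" "s - 1 / Suc (Suc n) < (\<integral>\<omega>. y \<omega> \<partial>M)"
      using ex[of "1 / Suc (Suc n)"] by auto
    obtain z where z: "z \<in> XX" "AE \<omega> in M. max (x \<omega>) (y \<omega>) \<le> z \<omega>"
      using dir[of x y] x y by auto
    have "(\<integral>\<omega>. y \<omega> \<partial>M) \<le> (\<integral>\<omega>. z \<omega> \<partial>M)"
      using z(2) by (intro integral_mono_AE int y(1) z(1)) auto
    then show "\<exists>y. (y \<in> XX \<and> s - 1 / Suc (Suc n) < (\<integral>\<omega>. y \<omega> \<partial>M)) \<and> (AE \<omega> in M. x \<omega> \<le> y \<omega>)"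
      using y z by (intro exI[of _ z]) auto
  qed
  then obtain f where f: "\<And>n. f n \<in> XX" "\<And>n. s - 1 / Suc n < (\<integral>\<omega>. f n \<omega> \<partial>M)"
    "\<And>n. AE \<omega> in M. f n \<omega> \<le> f (Suc n) \<omega>" by blast
  define Z where "Z = (\<lambda>\<omega>. lim (\<lambda>n. f n \<omega>))"
  have fmeas[measurable]: "f n \<in> borel_measurable M" for n using int[OF f(1)] by auto
  have Zmeas[measurable]: "Z \<in> borel_measurable M" unfolding Z_def by measurable
  have fD: "AE \<omega> in M. norm (f n \<omega>) \<le> D \<omega>" for n using D(2)[OF f(1)[of n]] by simp
  have D': "AE \<omega> in M. \<forall>n. \<bar>f n \<omega>\<bar> \<le> D \<omega>" using fD unfolding AE_all_countable by simp
  have mono: "AE \<omega> in M. \<forall>n. f n \<omega> \<le> f (Suc n) \<omega>" unfolding AE_all_countable using f(3) by blast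
  have lim: "AE \<omega> in M. (\<lambda>n. f n \<omega>) \<longlonglongrightarrow> Z \<omega>" using D' mono
  proof eventually_elim
    case (elim \<omega>)
    then have "incseq (\<lambda>n. f n \<omega>)" by (auto intro: incseq_SucI)
    moreover have "\<forall>n. f n \<omega> \<le> D \<omega>" using elim(1) by (auto simp: abs_le_iff)
    ultimately obtain L where "(\<lambda>n. f n \<omega>) \<longlonglongrightarrow> L" by (rule incseq_convergent)
    then show ?case unfolding Z_def by (simp add: limI)
  qed
  have Zint: "integrable M Z"
    by (rule integrable_dominated_convergence[OF Zmeas _ D(1) lim]) (rule fmeas, rule fD)
  have Zs: "s \<le> (\<integral>\<omega>. Z \<omega> \<partial>M)"
  proof (rule LIMSEQ_le)
    show "(\<lambda>n. \<integral>\<omega>. f n \<omega> \<partial>M) \<longlonglongrightarrow> (\<integral>\<omega>. Z \<omega> \<partial>M)"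
      by (rule integral_dominated_convergence[OF Zmeas _ D(1) lim]) (rule fmeas, rule fD)
    show "(\<lambda>n. s - 1 / Suc n) \<longlonglongrightarrow> s"
      using tendsto_diff[OF tendsto_const[of s] LIMSEQ_inverse_real_of_nat]
      by (simp add: inverse_eq_divide)
    show "\<exists>N. \<forall>n\<ge>N. s - 1 / Suc n \<le> (\<integral>\<omega>. f n \<omega> \<partial>M)" using less_imp_le[OF f(2)] by auto
  qed
  have Zub: "AE \<omega> in M. X \<omega> \<le> Z \<omega>" if X: "X \<in> XX" for X
  proof -
    note Xint = int[OF X]
    have [measurable]: "X \<in> borel_measurable M" using Xint by auto
    have "(\<integral>\<omega>. max (Z \<omega>) (X \<omega>) \<partial>M) \<le> s"
    proof (rule LIMSEQ_le_const2)
      show "(\<lambda>n. \<integral>\<omega>. max (f n \<omega>) (X \<omega>) \<partial>M) \<longlonglongrightarrow> (\<integral>\<omega>. max (Z \<omega>) (X \<omega>) \<partial>M)"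
      proof (rule integral_dominated_convergence[OF _ _ D(1)])
        show "AE \<omega> in M. (\<lambda>n. max (f n \<omega>) (X \<omega>)) \<longlonglongrightarrow> max (Z \<omega>) (X \<omega>)"
          using lim by eventually_elim (rule tendsto_max[OF _ tendsto_const])
        show "AE \<omega> in M. norm (max (f n \<omega>) (X \<omega>)) \<le> D \<omega>" for n
          using D(2)[OF X] fD[of n] by eventually_elim auto
      qed auto
      show "\<exists>N. \<forall>n\<ge>N. (\<integral>\<omega>. max (f n \<omega>) (X \<omega>) \<partial>M) \<le> s"
      proof (intro exI allI impI)
        fix n
        obtain z where z: "z \<in> XX" "AE \<omega> in M. max (f n \<omega>) (X \<omega>) \<le> z \<omega>"
          using dir[OF f(1) X] by blast
        have "(\<integral>\<omega>. max (f n \<omega>) (X \<omega>) \<partial>M) \<le> (\<integral>\<omega>. z \<omega> \<partial>M)"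
          by (intro integral_mono_AE integrable_max int[OF f(1)] Xint int[OF z(1)] z(2))
        also have "\<dots> \<le> s" by (rule s_ub[OF z(1)])
        finally show "(\<integral>\<omega>. max (f n \<omega>) (X \<omega>) \<partial>M) \<le> s" .
      qed
    qed
    moreover have mint: "integrable M (\<lambda>\<omega>. max (Z \<omega>) (X \<omega>))" using Zint Xint by (rule integrable_max)
    ultimately have "(\<integral>\<omega>. max (Z \<omega>) (X \<omega>) - Z \<omega> \<partial>M) \<le> 0"
      using Zs Zint by (subst Bochner_Integration.integral_diff) auto
    moreover have "(\<integral>\<omega>. max (Z \<omega>) (X \<omega>) - Z \<omega> \<partial>M) \<ge> 0" by (rule integral_nonneg_AE) simp
    ultimately have "(\<integral>\<omega>. max (Z \<omega>) (X \<omega>) - Z \<omega> \<partial>M) = 0" by (rule antisym)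
    then have "AE \<omega> in M. max (Z \<omega>) (X \<omega>) - Z \<omega> = 0"
      by (subst (asm) integral_nonneg_eq_0_iff_AE) (auto intro: Bochner_Integration.integrable_diff mint Zint)
    then show ?thesis by eventually_elim linarith
  qed
  have SZ: "AE \<omega> in M. S \<omega> \<le> Z \<omega>" using S Zub Zmeas unfolding is_ess_sup_def by blast
  have fS: "AE \<omega> in M. f 0 \<omega> \<le> S \<omega>" using S f(1) unfolding is_ess_sup_def by blast
  have fZ: "(\<integral>\<omega>. Z \<omega> \<partial>M) \<le> s"
  proof (rule LIMSEQ_le_const2)
    show "(\<lambda>n. \<integral>\<omega>. f n \<omega> \<partial>M) \<longlonglongrightarrow> (\<integral>\<omega>. Z \<omega> \<partial>M)"
      by (rule integral_dominated_convergence[OF Zmeas _ D(1) lim]) (rule fmeas, rule fD)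
    show "\<exists>N. \<forall>n\<ge>N. (\<integral>\<omega>. f n \<omega> \<partial>M) \<le> s" using s_ub[OF f(1)] by blast
  qed
  have "integrable M S"
  proof (rule Bochner_Integration.integrable_bound[of M "\<lambda>\<omega>. \<bar>f 0 \<omega>\<bar> + \<bar>Z \<omega>\<bar>"])
    show "integrable M (\<lambda>\<omega>. \<bar>f 0 \<omega>\<bar> + \<bar>Z \<omega>\<bar>)" using Zint int[OF f(1)] by simp
    show "AE \<omega> in M. norm (S \<omega>) \<le> norm (\<bar>f 0 \<omega>\<bar> + \<bar>Z \<omega>\<bar>)"
      using SZ fS by eventually_elim auto
  qed simp
  then have "(\<integral>\<omega>. S \<omega> \<partial>M) \<le> (\<integral>\<omega>. Z \<omega> \<partial>M)" using Zint SZ by (intro integral_mono_AE)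
  then show ?thesis using fZ sc by linarith
qed

section \<open>Filtrations, joint measurability and conditional expectations\<close>

locale filtered_prob_space = prob_space M for M :: "'a measure" +
  fixes F :: "real \<Rightarrow> 'a measure"
  assumes filtration: "filtration (space M) F"
    and subalgebra: "\<And>t. subalgebra M (F t)"
begin

lemma space_F[simp]: "space (F t) = space M"
  using subalgebra unfolding subalgebra_def by blast

lemma sets_F_subset: "sets (F t) \<subseteq> sets M"
  using subalgebra unfolding subalgebra_def by blast

lemma sets_F_mono: "s \<le> t \<Longrightarrow> sets (F s) \<subseteq> sets (F t)"
  using filtration unfolding filtration_def by blast

lemma space_F_infinity[simp]: "space (F_infinity M F) = space M"
  unfolding F_infinity_def by (rule space_measure_of) (use sets.space_closed in force)

lemma sets_F_infinity: "sets (F_infinity M F) = sigma_sets (space M) (\<Union>t\<in>{0..}. sets (F t))"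
  unfolding F_infinity_def by (rule sets_measure_of) (use sets.space_closed in force)

lemma sets_F_infinity_subset: "sets (F_infinity M F) \<subseteq> sets M"
  unfolding sets_F_infinity using sets_F_subset by (intro sets.sigma_sets_subset) auto

lemma sets_F_subset_infinity: "0 \<le> t \<Longrightarrow> sets (F t) \<subseteq> sets (F_infinity M F)"
  unfolding sets_F_infinity by (auto intro: sigma_sets.Basic)

lemma subalgebra_F_infinity: "subalgebra M (F_infinity M F)"
  unfolding subalgebra_def using sets_F_infinity_subset by simp

sublocale sub: sigma_finite_subalgebra M "F t" for t
  using subalgebra by (intro finite_measure_subalgebra_is_sigma_finite)
    (simp add: finite_measure_subalgebra_def finite_measure_subalgebra_axioms_def finite_measure_axioms)

text \<open>
  The arguments come in the order used for aggregating processes, outcome first.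
\<close>

definition jointly_measurable :: "(real \<Rightarrow> 'a \<Rightarrow> real) \<Rightarrow> bool" where
  "jointly_measurable W \<longleftrightarrow>
     (\<lambda>(\<omega>, t). W t \<omega>) \<in> borel_measurable (F_infinity M F \<Otimes>\<^sub>M restrict_space borel {0..})"

text \<open>
  The process stopped at the deterministic time \<open>n\<close> is \<open>F\<^sub>n\<close>-jointly measurable, and the
  stopped processes are eventually equal to the process at each fixed time.
\<close>

lemma progressively_measurable_imp_jointly_measurable:
  assumes "progressively_measurable F X"
  shows "jointly_measurable X"
  unfolding jointly_measurable_def
proof (rule borel_measurable_LIMSEQ_metric)
  fix n :: nat
  let ?n = "real n"
  have X: "(\<lambda>(s, \<omega>). X s \<omega>) \<in> borel_measurable (restrict_space borel {0..?n} \<Otimes>\<^sub>M F ?n)"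
    using assms unfolding progressively_measurable_def by simp
  have id: "(\<lambda>\<omega>. \<omega>) \<in> measurable (F_infinity M F) (F ?n)"
    using sets_F_subset_infinity[of ?n] by (intro measurableI) (auto simp: sets.sets_into_space)
  have m: "(\<lambda>p. (min (snd p) ?n, fst p))
      \<in> measurable (F_infinity M F \<Otimes>\<^sub>M restrict_space borel {0..}) (restrict_space borel {0..?n} \<Otimes>\<^sub>M F ?n)"
  proof (rule measurable_Pair)
    have "snd \<in> borel_measurable (F_infinity M F \<Otimes>\<^sub>M restrict_space (borel :: real measure) {0..})"
      by (rule measurable_compose[OF measurable_snd]) (simp add: measurable_restrict_space1)
    then show "(\<lambda>p. min (snd p) ?n) \<in> measurable (F_infinity M F \<Otimes>\<^sub>M restrict_space borel {0..}) (restrict_space borel {0..?n})"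
      by (intro measurable_restrict_space2) (auto simp: space_pair_measure)
    show "fst \<in> measurable (F_infinity M F \<Otimes>\<^sub>M restrict_space (borel :: real measure) {0..}) (F ?n)"
      by (rule measurable_compose[OF measurable_fst id])
  qed
  show "(\<lambda>(\<omega>, t). X (min t ?n) \<omega>) \<in> borel_measurable (F_infinity M F \<Otimes>\<^sub>M restrict_space borel {0..})"
    using measurable_compose[OF m X] by (simp add: case_prod_beta)
next
  fix p :: "'a \<times> real"
  have "eventually (\<lambda>n. snd p \<le> real n) sequentially"
    by (meson eventually_sequentiallyI le_trans of_nat_le_iff real_arch_simple order_trans)
  then show "(\<lambda>n. (case p of (\<omega>, t) \<Rightarrow> X (min t (real n)) \<omega>)) \<longlonglongrightarrow> (case p of (\<omega>, t) \<Rightarrow> X t \<omega>)"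
    by (intro tendsto_eventually) (auto elim!: eventually_mono simp: min_absorb1 split: prod.split)
qed

text \<open>
  Clipping the time at 0 gives a function on the whole real line, so that laws of maturities may be
  taken on the Borel sets of the line.  Time comes first because Fubini's theorem will integrate over
  the outcome inside.
\<close>

lemma jointly_measurable_shift:
  assumes "jointly_measurable W"
  shows "(\<lambda>p. W (max 0 (t + fst p)) (snd p)) \<in> borel_measurable (borel \<Otimes>\<^sub>M F_infinity M F)"
proof -
  have "(\<lambda>p. (snd p, max 0 (t + fst p)))
      \<in> measurable (borel \<Otimes>\<^sub>M F_infinity M F) (F_infinity M F \<Otimes>\<^sub>M restrict_space borel {0..})"
    by (intro measurable_Pair measurable_restrict_space2) auto
  from measurable_compose[OF this assms[unfolded jointly_measurable_def]]
  show ?thesis by simp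
qed

lemma jointly_measurable_section:
  assumes "jointly_measurable W" "0 \<le> t"
  shows "W t \<in> borel_measurable M"
proof -
  have "W t \<in> borel_measurable (F_infinity M F)"
    using measurable_compose[OF measurable_Pair1' jointly_measurable_shift[OF assms(1), of 0], of t]
      assms(2) by simp
  then show ?thesis by (rule measurable_from_subalg[OF subalgebra_F_infinity])
qed

text \<open>
  Independence in the form needed for Fubini's theorem: the whole outcome, seen through \<open>F\<^sub>\<infinity>\<close>, is
  the second of the two independent variables.
\<close>

lemma distr_maturity_pair:
  assumes "\<zeta> \<in> randomized_maturities M F"
  shows "distr M borel \<zeta> \<Otimes>\<^sub>M distr M (F_infinity M F) (\<lambda>\<omega>. \<omega>)
    = distr M (borel \<Otimes>\<^sub>M F_infinity M F) (\<lambda>\<omega>. (\<zeta> \<omega>, \<omega>))"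
proof -
  have meas: "\<zeta> \<in> borel_measurable M" and
    ind: "indep_set (sets (F_infinity M F)) {\<zeta> -` B \<inter> space M | B. B \<in> sets borel}"
    using assms unfolding randomized_maturities_def by auto
  have id: "(\<lambda>\<omega>. \<omega>) \<in> measurable M (F_infinity M F)"
    using sets_F_infinity_subset by (intro measurableI) (auto simp: sets.sets_into_space Int_absorb2)
  interpret L: prob_space "distr M borel \<zeta>" by (rule prob_space_distr[OF meas])
  interpret N: prob_space "distr M (F_infinity M F) (\<lambda>\<omega>. \<omega>)" by (rule prob_space_distr[OF id])
  have pair: "(\<lambda>\<omega>. (\<zeta> \<omega>, \<omega>)) \<in> measurable M (borel \<Otimes>\<^sub>M F_infinity M F)"
    using meas id by simp
  show ?thesis
  proof (rule pair_measure_eqI)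
    fix B A
    assume "B \<in> sets (distr M borel \<zeta>)" and "A \<in> sets (distr M (F_infinity M F) (\<lambda>\<omega>. \<omega>))"
    then have B: "B \<in> sets borel" and A: "A \<in> sets (F_infinity M F)" by auto
    have "A \<inter> space M = A" using sets.sets_into_space[OF A] by auto
    moreover have "prob (A \<inter> (\<zeta> -` B \<inter> space M)) = prob A * prob (\<zeta> -` B \<inter> space M)"
      using indep_setD[OF ind A] B by blast
    moreover have "(\<lambda>\<omega>. (\<zeta> \<omega>, \<omega>)) -` (B \<times> A) \<inter> space M = A \<inter> (\<zeta> -` B \<inter> space M)" by auto
    ultimately show "emeasure (distr M borel \<zeta>) B * emeasure (distr M (F_infinity M F) (\<lambda>\<omega>. \<omega>)) A
        = emeasure (distr M (borel \<Otimes>\<^sub>M F_infinity M F) (\<lambda>\<omega>. (\<zeta> \<omega>, \<omega>))) (B \<times> A)"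
      using A B
      by (simp add: emeasure_distr[OF meas B] emeasure_distr[OF id A] emeasure_distr[OF pair]
          emeasure_eq_measure ennreal_mult'[symmetric] mult.commute)
  qed (unfold_locales, simp)
qed

lemma randomized_maturity_measurable: "\<zeta> \<in> randomized_maturities M F \<Longrightarrow> \<zeta> \<in> borel_measurable M"
  and randomized_maturity_nonneg: "\<zeta> \<in> randomized_maturities M F \<Longrightarrow> \<omega> \<in> space M \<Longrightarrow> 0 \<le> \<zeta> \<omega>"
  unfolding randomized_maturities_def by auto

text \<open>
  Test on the part of \<open>A\<close> where the inequality fails.
\<close>

lemma AE_le_on_of_integral_le:
  fixes X Z :: "'a \<Rightarrow> real"
  assumes X: "X \<in> borel_measurable (F t)" "integrable M X"
    and Z: "Z \<in> borel_measurable (F t)" "integrable M Z"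
    and A: "A \<in> sets (F t)"
    and le: "\<And>B. B \<in> sets (F t) \<Longrightarrow> B \<subseteq> A \<Longrightarrow>
      (\<integral>\<omega>. indicator B \<omega> * X \<omega> \<partial>M) \<le> (\<integral>\<omega>. indicator B \<omega> * Z \<omega> \<partial>M)"
  shows "AE \<omega> in M. \<omega> \<in> A \<longrightarrow> X \<omega> \<le> Z \<omega>"
proof -
  define B where "B = A \<inter> {\<omega> \<in> space (F t). Z \<omega> < X \<omega>}"
  have B: "B \<in> sets (F t)" unfolding B_def using A borel_measurable_less[OF Z(1) X(1)] by (rule sets.Int)
  then have BM: "B \<in> sets M" using sets_F_subset by auto
  have int: "integrable M (\<lambda>\<omega>. indicator B \<omega> * X \<omega>)" "integrable M (\<lambda>\<omega>. indicator B \<omega> * Z \<omega>)"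
    using integrable_mult_indicator[OF BM X(2)] integrable_mult_indicator[OF BM Z(2)] by simp_all
  let ?g = "\<lambda>\<omega>. indicator B \<omega> * X \<omega> - indicator B \<omega> * Z \<omega>"
  have g: "integrable M ?g" using int by simp
  have nn: "AE \<omega> in M. 0 \<le> ?g \<omega>" by (rule AE_I2) (auto simp: B_def indicator_def)
  have "(\<integral>\<omega>. ?g \<omega> \<partial>M) \<le> 0"
    using le[OF B] int by (subst Bochner_Integration.integral_diff) (auto simp: B_def)
  then have "(\<integral>\<omega>. ?g \<omega> \<partial>M) = 0" using integral_nonneg_AE[OF nn] by linarith
  then have "AE \<omega> in M. ?g \<omega> = 0" using integral_nonneg_eq_0_iff_AE[OF g nn] by blast
  moreover have "AE \<omega> in M. \<omega> \<in> space M" by (rule AE_space)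
  ultimately show ?thesis by eventually_elim (auto simp: B_def indicator_def split: if_splits)
qed

text \<open>
  Over an event of probability 0 or 1, \<open>X\<close> and its expectation have the same integral.
\<close>

lemma AE_eq_expectation_of_trivial:
  fixes X :: "'a \<Rightarrow> real"
  assumes "trivial_at_0 M F" and X: "X \<in> borel_measurable (F 0)" "integrable M X"
  shows "AE \<omega> in M. X \<omega> = (\<integral>\<omega>. X \<omega> \<partial>M)"
proof -
  let ?c = "\<integral>\<omega>. X \<omega> \<partial>M"
  have eq: "(\<integral>\<omega>. indicator B \<omega> * X \<omega> \<partial>M) = (\<integral>\<omega>. indicator B \<omega> * ?c \<partial>M)" if B: "B \<in> sets (F 0)" for B
  proof -
    have BM: "B \<in> sets M" using B sets_F_subset by auto
    note [measurable] = BM borel_measurable_integrable[OF X(2)]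
    consider "prob B = 0" | "prob B = 1" using assms(1) B unfolding trivial_at_0_def by blast
    then show ?thesis
    proof cases
      case 1
      then have "AE \<omega> in M. \<omega> \<notin> B" using BM by (simp add: prob_eq_0)
      then have "AE \<omega> in M. indicator B \<omega> * X \<omega> = indicator B \<omega> * ?c" by eventually_elim simp
      then show ?thesis by (rule integral_cong_AE[rotated 2]) auto
    next
      case 2
      then have in_B: "AE \<omega> in M. \<omega> \<in> B" using BM by (simp add: prob_eq_1)
      have "(\<integral>\<omega>. indicator B \<omega> * X \<omega> \<partial>M) = ?c"
      proof (rule integral_cong_AE)
        show "AE \<omega> in M. indicator B \<omega> * X \<omega> = X \<omega>" using in_B by eventually_elim simp
      qed measurable
      moreover have "(\<integral>\<omega>. indicator B \<omega> * ?c \<partial>M) = ?c" using 2 BM by simp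
      ultimately show ?thesis by simp
    qed
  qed
  have top: "space M \<in> sets (F 0)" using sets.top[of "F 0"] by simp
  have "AE \<omega> in M. \<omega> \<in> space M \<longrightarrow> X \<omega> \<le> ?c"
    by (rule AE_le_on_of_integral_le[OF X _ _ top]) (simp_all add: eq)
  moreover have "AE \<omega> in M. \<omega> \<in> space M \<longrightarrow> ?c \<le> X \<omega>"
    by (rule AE_le_on_of_integral_le[OF _ _ X top]) (simp_all add: eq)
  moreover have "AE \<omega> in M. \<omega> \<in> space M" by (rule AE_space)
  ultimately show ?thesis by eventually_elim auto
qed

definition continuation :: "(real \<Rightarrow> 'a \<Rightarrow> real) \<Rightarrow> ('a \<Rightarrow> real) \<Rightarrow> real \<Rightarrow> 'a \<Rightarrow> real" where
  "continuation W \<zeta> t = real_cond_exp M (F t) (\<lambda>\<omega>. W (t + \<zeta> \<omega>) \<omega>)"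

lemma continuation_measurable: "continuation W \<zeta> t \<in> borel_measurable (F t)"
  unfolding continuation_def by simp

end

section \<open>Continuation values of processes dominated by a martingale\<close>

locale martingale_bound = filtered_prob_space +
  fixes MY :: "real \<Rightarrow> 'a \<Rightarrow> real"
  assumes martingale: "martingale_on M F MY"
begin

lemma bound_measurable: "0 \<le> t \<Longrightarrow> MY t \<in> borel_measurable (F t)"
  and bound_integrable: "0 \<le> t \<Longrightarrow> integrable M (MY t)"
  using martingale unfolding martingale_on_def by auto

lemma bound_integral:
  assumes "0 \<le> s" "s \<le> t" "A \<in> sets (F s)"
  shows "(\<integral>\<omega>. indicator A \<omega> * MY t \<omega> \<partial>M) = (\<integral>\<omega>. indicator A \<omega> * MY s \<omega> \<partial>M)"
proof -
  have A: "A \<in> sets M" using assms(3) sets_F_subset by auto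
  have int: "integrable M (MY t)" using assms bound_integrable by simp
  then have "integrable M (\<lambda>\<omega>. indicator A \<omega> * MY t \<omega>)"
    using integrable_mult_indicator[OF A int] by simp
  then have "(\<integral>\<omega>. indicator A \<omega> * MY t \<omega> \<partial>M) = (\<integral>\<omega>. indicator A \<omega> * real_cond_exp M (F s) (MY t) \<omega> \<partial>M)"
    using int assms(3) by (subst sub.real_cond_exp_intg(2)) auto
  also have "\<dots> = (\<integral>\<omega>. indicator A \<omega> * MY s \<omega> \<partial>M)"
  proof (rule integral_cong_AE)
    have "AE \<omega> in M. real_cond_exp M (F s) (MY t) \<omega> = MY s \<omega>"
      using martingale assms unfolding martingale_on_def by auto
    then show "AE \<omega> in M. indicator A \<omega> * real_cond_exp M (F s) (MY t) \<omega> = indicator A \<omega> * MY s \<omega>"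
      by eventually_elim simp
  qed (use A bound_integrable[OF assms(1)] in auto)
  finally show ?thesis .
qed

text \<open>
  The inequality is required for each time separately: this is what survives an essential supremum and
  the passage to an aggregating process.
\<close>

definition dominated :: "(real \<Rightarrow> 'a \<Rightarrow> real) \<Rightarrow> bool" where
  "dominated W \<longleftrightarrow> jointly_measurable W \<and> (\<forall>t\<ge>0. AE \<omega> in M. \<bar>W t \<omega>\<bar> \<le> MY t \<omega>)"

lemma dominated_AE: "dominated W \<Longrightarrow> 0 \<le> t \<Longrightarrow> AE \<omega> in M. \<bar>W t \<omega>\<bar> \<le> MY t \<omega>"
  unfolding dominated_def by auto

lemma dominated_measurable: "dominated W \<Longrightarrow> 0 \<le> t \<Longrightarrow> W t \<in> borel_measurable M"
  unfolding dominated_def using jointly_measurable_section by blast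

lemma dominated_integrable:
  assumes "dominated W" "0 \<le> t"
  shows "integrable M (W t)"
  using dominated_AE[OF assms] dominated_measurable[OF assms] bound_integrable[OF assms(2)]
  by (auto intro: Bochner_Integration.integrable_bound)

lemma dominated_abs_integral_le:
  assumes "dominated W" "0 \<le> t"
  shows "(\<integral>\<omega>. \<bar>W t \<omega>\<bar> \<partial>M) \<le> (\<integral>\<omega>. MY 0 \<omega> \<partial>M)"
proof -
  have "(\<integral>\<omega>. \<bar>W t \<omega>\<bar> \<partial>M) \<le> (\<integral>\<omega>. MY t \<omega> \<partial>M)"
    using dominated_AE[OF assms] dominated_integrable[OF assms] bound_integrable[OF assms(2)]
    by (intro integral_mono_AE) auto
  also have "\<dots> = (\<integral>\<omega>. indicator (space M) \<omega> * MY t \<omega> \<partial>M)"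
    by (intro Bochner_Integration.integral_cong) auto
  also have "\<dots> = (\<integral>\<omega>. indicator (space M) \<omega> * MY 0 \<omega> \<partial>M)"
    using assms(2) sets.top[of "F 0"] by (intro bound_integral) auto
  also have "\<dots> = (\<integral>\<omega>. MY 0 \<omega> \<partial>M)"
    by (intro Bochner_Integration.integral_cong) auto
  finally show ?thesis .
qed

lemma dominated_integral_bound:
  assumes "dominated W" "0 \<le> t"
  shows "\<bar>\<integral>\<omega>. W t \<omega> \<partial>M\<bar> \<le> (\<integral>\<omega>. MY 0 \<omega> \<partial>M)"
  using integral_abs_bound[of M "W t"] dominated_abs_integral_le[OF assms] by linarith

lemma section_integral_measurable:
  assumes W: "dominated W" and A: "A \<in> sets (F_infinity M F)"
  shows "(\<lambda>z. \<integral>\<omega>. indicator A \<omega> * W (max 0 (t + z)) \<omega> \<partial>M) \<in> borel_measurable borel"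
proof -
  let ?N = "distr M (F_infinity M F) (\<lambda>\<omega>. \<omega>)"
  have id: "(\<lambda>\<omega>. \<omega>) \<in> measurable M (F_infinity M F)"
    using sets_F_infinity_subset by (intro measurableI) (auto simp: sets.sets_into_space Int_absorb2)
  interpret N: prob_space ?N by (rule prob_space_distr[OF id])
  have f: "(\<lambda>p. indicator A (snd p) * W (max 0 (t + fst p)) (snd p)) \<in> borel_measurable (borel \<Otimes>\<^sub>M ?N)"
    using jointly_measurable_shift[of W t] W A unfolding dominated_def by simp
  have "(\<lambda>z. \<integral>\<omega>. indicator A \<omega> * W (max 0 (t + z)) \<omega> \<partial>?N) \<in> borel_measurable borel"
    using N.borel_measurable_lebesgue_integral[of "\<lambda>z \<omega>. indicator A \<omega> * W (max 0 (t + z)) \<omega>" borel] f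
    by (simp add: case_prod_beta)
  moreover have "(\<integral>\<omega>. indicator A \<omega> * W (max 0 (t + z)) \<omega> \<partial>?N)
      = (\<integral>\<omega>. indicator A \<omega> * W (max 0 (t + z)) \<omega> \<partial>M)" for z
    by (rule integral_distr[OF id]) (use measurable_compose[OF measurable_Pair1' f, of z] in simp)
  ultimately show ?thesis by simp
qed

text \<open>
  Freezing the maturity: by independence of \<open>\<zeta>\<close> and \<open>F\<^sub>\<infinity>\<close> the integral over the diagonal is a
  double integral over the product of \<open>P\<^sub>\<zeta>\<close> and \<open>P\<close>.  Integrability on the product holds since the
  inner integral of the absolute value is at most the expectation of \<open>M\<^sup>Y\<close>, the same at all times.
\<close>

lemma
  assumes W: "dominated W" and \<zeta>: "\<zeta> \<in> randomized_maturities M F"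
    and t: "0 \<le> t" and A: "A \<in> sets (F_infinity M F)"
  shows maturity_integrable: "integrable M (\<lambda>\<omega>. indicator A \<omega> * W (t + \<zeta> \<omega>) \<omega>)"
    and averaged_integrable:
      "integrable M (\<lambda>\<omega>'. \<integral>\<omega>. indicator A \<omega> * W (t + \<zeta> \<omega>') \<omega> \<partial>M)"
    and maturity_integral:
      "(\<integral>\<omega>. indicator A \<omega> * W (t + \<zeta> \<omega>) \<omega> \<partial>M)
         = (\<integral>\<omega>'. \<integral>\<omega>. indicator A \<omega> * W (t + \<zeta> \<omega>') \<omega> \<partial>M \<partial>M)"
proof -
  let ?N = "distr M (F_infinity M F) (\<lambda>\<omega>. \<omega>)"
  let ?L = "distr M borel \<zeta>"
  let ?f = "\<lambda>p. indicator A (snd p) * W (max 0 (t + fst p)) (snd p)"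
  let ?C = "\<integral>\<omega>. MY 0 \<omega> \<partial>M"
  have id: "(\<lambda>\<omega>. \<omega>) \<in> measurable M (F_infinity M F)"
    using sets_F_infinity_subset by (intro measurableI) (auto simp: sets.sets_into_space Int_absorb2)
  have [measurable]: "\<zeta> \<in> borel_measurable M" by (rule randomized_maturity_measurable[OF \<zeta>])
  interpret N: prob_space ?N by (rule prob_space_distr[OF id])
  interpret L: prob_space ?L by (rule prob_space_distr) simp
  interpret LN: pair_prob_space ?L ?N ..
  have Ain: "A \<in> sets M" using A sets_F_infinity_subset by auto
  have f: "?f \<in> borel_measurable (borel \<Otimes>\<^sub>M F_infinity M F)"
    using jointly_measurable_shift[of W t] W A unfolding dominated_def by simp
  then have fLN: "?f \<in> borel_measurable (?L \<Otimes>\<^sub>M ?N)" by simp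
  have sec: "(\<lambda>\<omega>. ?f (z, \<omega>)) \<in> borel_measurable (F_infinity M F)" for z
    using measurable_compose[OF measurable_Pair1' f, of z] by simp
  have intM: "integrable M (\<lambda>\<omega>. ?f (z, \<omega>))" for z
    using integrable_mult_indicator[OF Ain dominated_integrable[OF W, of "max 0 (t + z)"]] by simp
  have intN: "integrable ?N (\<lambda>\<omega>. ?f (z, \<omega>))" for z
    using integrable_distr_eq[OF id sec] intM by simp
  have eqN: "(\<integral>\<omega>. g (?f (z, \<omega>)) \<partial>?N) = (\<integral>\<omega>. g (?f (z, \<omega>)) \<partial>M)"
    if "g \<in> borel_measurable borel" for g :: "real \<Rightarrow> real" and z
    by (rule integral_distr[OF id]) (use measurable_compose[OF sec that] in simp)
  have bnd: "(\<integral>\<omega>. \<bar>?f (z, \<omega>)\<bar> \<partial>M) \<le> ?C" for z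
  proof -
    have "(\<integral>\<omega>. \<bar>?f (z, \<omega>)\<bar> \<partial>M) \<le> (\<integral>\<omega>. \<bar>W (max 0 (t + z)) \<omega>\<bar> \<partial>M)"
      using intM[of z] dominated_integrable[OF W, of "max 0 (t + z)"]
      by (intro integral_mono) (auto simp: indicator_def)
    also have "\<dots> \<le> ?C" by (rule dominated_abs_integral_le[OF W]) simp
    finally show ?thesis .
  qed
  have intLN: "integrable (?L \<Otimes>\<^sub>M ?N) ?f"
  proof (rule LN.Fubini_integrable[OF fLN])
    have "(\<lambda>z. \<integral>\<omega>. norm (?f (z, \<omega>)) \<partial>?N) \<in> borel_measurable borel"
      using N.borel_measurable_lebesgue_integral[of "\<lambda>z \<omega>. norm (?f (z, \<omega>))" borel] f
      by (simp add: case_prod_beta)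
    moreover have "\<bar>\<integral>\<omega>. norm (?f (z, \<omega>)) \<partial>?N\<bar> \<le> ?C" for z
      using bnd[of z] eqN[of abs z] by simp
    ultimately show "integrable ?L (\<lambda>z. \<integral>\<omega>. norm (?f (z, \<omega>)) \<partial>?N)"
      by (intro L.integrable_const_bound[of _ ?C] AE_I2) (simp_all only: real_norm_def abs_abs measurable_distr_eq1)
  qed (use intN in auto)
  have pair: "(\<lambda>\<omega>. (\<zeta> \<omega>, \<omega>)) \<in> measurable M (borel \<Otimes>\<^sub>M F_infinity M F)"
    using id by simp
  have eqpair: "?L \<Otimes>\<^sub>M ?N = distr M (borel \<Otimes>\<^sub>M F_infinity M F) (\<lambda>\<omega>. (\<zeta> \<omega>, \<omega>))"
    by (rule distr_maturity_pair[OF \<zeta>])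
  have clip: "max 0 (t + \<zeta> \<omega>) = t + \<zeta> \<omega>" if "\<omega> \<in> space M" for \<omega>
    using randomized_maturity_nonneg[OF \<zeta> that] t by simp
  have "integrable M (\<lambda>\<omega>. ?f (\<zeta> \<omega>, \<omega>))"
    using intLN unfolding eqpair integrable_distr_eq[OF pair f] .
  then show "integrable M (\<lambda>\<omega>. indicator A \<omega> * W (t + \<zeta> \<omega>) \<omega>)"
    by (rule Bochner_Integration.integrable_cong[THEN iffD1, rotated -1]) (auto simp: clip)
  have meas1: "(\<lambda>z. \<integral>\<omega>. ?f (z, \<omega>) \<partial>M) \<in> borel_measurable borel"
    using section_integral_measurable[OF W A, of t] by simp
  have "integrable M (\<lambda>\<omega>'. \<integral>\<omega>. ?f (\<zeta> \<omega>', \<omega>) \<partial>M)"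
  proof (rule integrable_const_bound[of _ ?C])
    show "AE \<omega>' in M. norm (\<integral>\<omega>. ?f (\<zeta> \<omega>', \<omega>) \<partial>M) \<le> ?C"
    proof (rule AE_I2)
      fix \<omega>'
      show "norm (\<integral>\<omega>. ?f (\<zeta> \<omega>', \<omega>) \<partial>M) \<le> ?C"
        unfolding real_norm_def by (rule order_trans[OF integral_abs_bound bnd])
    qed
  qed (rule measurable_compose[OF randomized_maturity_measurable[OF \<zeta>] meas1])
  then show "integrable M (\<lambda>\<omega>'. \<integral>\<omega>. indicator A \<omega> * W (t + \<zeta> \<omega>') \<omega> \<partial>M)"
    by (rule Bochner_Integration.integrable_cong[THEN iffD1, rotated -1]) (auto simp: clip)
  have "(\<integral>\<omega>. indicator A \<omega> * W (t + \<zeta> \<omega>) \<omega> \<partial>M) = (\<integral>\<omega>. ?f (\<zeta> \<omega>, \<omega>) \<partial>M)"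
    by (rule Bochner_Integration.integral_cong) (auto simp: clip)
  also have "\<dots> = integral\<^sup>L (?L \<Otimes>\<^sub>M ?N) ?f"
    unfolding eqpair by (rule integral_distr[OF pair f, symmetric])
  also have "\<dots> = (\<integral>z. \<integral>\<omega>. ?f (z, \<omega>) \<partial>?N \<partial>?L)"
    by (rule LN.integral_fst'[OF intLN, symmetric])
  also have "\<dots> = (\<integral>z. \<integral>\<omega>. ?f (z, \<omega>) \<partial>M \<partial>?L)"
    using eqN[of "\<lambda>x. x"] by simp
  also have "\<dots> = (\<integral>\<omega>'. \<integral>\<omega>. ?f (\<zeta> \<omega>', \<omega>) \<partial>M \<partial>M)"
    by (rule integral_distr[OF _ meas1]) simp
  also have "\<dots> = (\<integral>\<omega>'. \<integral>\<omega>. indicator A \<omega> * W (t + \<zeta> \<omega>') \<omega> \<partial>M \<partial>M)"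
    by (intro Bochner_Integration.integral_cong) (auto simp: clip)
  finally show "(\<integral>\<omega>. indicator A \<omega> * W (t + \<zeta> \<omega>) \<omega> \<partial>M)
         = (\<integral>\<omega>'. \<integral>\<omega>. indicator A \<omega> * W (t + \<zeta> \<omega>') \<omega> \<partial>M \<partial>M)" .
qed

lemma expectation_maturity:
  assumes W: "dominated W" and \<zeta>: "\<zeta> \<in> randomized_maturities M F" and t: "0 \<le> t"
  shows "integrable M (\<lambda>\<omega>. W (t + \<zeta> \<omega>) \<omega>)"
    and "integrable M (\<lambda>\<omega>'. \<integral>\<omega>. W (t + \<zeta> \<omega>') \<omega> \<partial>M)"
    and "(\<integral>\<omega>. W (t + \<zeta> \<omega>) \<omega> \<partial>M) = (\<integral>\<omega>'. \<integral>\<omega>. W (t + \<zeta> \<omega>') \<omega> \<partial>M \<partial>M)"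
proof -
  have top: "space M \<in> sets (F_infinity M F)" using sets.top[of "F_infinity M F"] by simp
  have drop: "(\<integral>\<omega>. indicator (space M) \<omega> * g \<omega> \<partial>M) = (\<integral>\<omega>. g \<omega> \<partial>M)"
    "integrable M (\<lambda>\<omega>. indicator (space M) \<omega> * g \<omega>) \<longleftrightarrow> integrable M g" for g :: "'a \<Rightarrow> real"
    by (intro Bochner_Integration.integral_cong Bochner_Integration.integrable_cong; simp)+
  show "integrable M (\<lambda>\<omega>. W (t + \<zeta> \<omega>) \<omega>)"
    and "integrable M (\<lambda>\<omega>'. \<integral>\<omega>. W (t + \<zeta> \<omega>') \<omega> \<partial>M)"
    and "(\<integral>\<omega>. W (t + \<zeta> \<omega>) \<omega> \<partial>M) = (\<integral>\<omega>'. \<integral>\<omega>. W (t + \<zeta> \<omega>') \<omega> \<partial>M \<partial>M)"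
    using maturity_integrable[OF W \<zeta> t top] averaged_integrable[OF W \<zeta> t top]
      maturity_integral[OF W \<zeta> t top] unfolding drop by blast+
qed

lemma continuation_integrable:
  assumes "dominated W" "\<zeta> \<in> randomized_maturities M F" "0 \<le> t"
  shows "integrable M (continuation W \<zeta> t)"
  unfolding continuation_def by (intro sub.real_cond_exp_int expectation_maturity assms)

lemma continuation_expectation:
  assumes "dominated W" "\<zeta> \<in> randomized_maturities M F" "0 \<le> t"
  shows "(\<integral>\<omega>. continuation W \<zeta> t \<omega> \<partial>M) = (\<integral>\<omega>'. \<integral>\<omega>. W (t + \<zeta> \<omega>') \<omega> \<partial>M \<partial>M)"
  unfolding continuation_def
  by (simp add: sub.real_cond_exp_int(2)[OF expectation_maturity(1)[OF assms]]
      expectation_maturity(3)[OF assms])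

lemma continuation_integral:
  assumes W: "dominated W" and \<zeta>: "\<zeta> \<in> randomized_maturities M F" and t: "0 \<le> t"
    and A: "A \<in> sets (F t)"
  shows "(\<integral>\<omega>. indicator A \<omega> * continuation W \<zeta> t \<omega> \<partial>M)
    = (\<integral>\<omega>'. \<integral>\<omega>. indicator A \<omega> * W (t + \<zeta> \<omega>') \<omega> \<partial>M \<partial>M)"
proof -
  have A': "A \<in> sets (F_infinity M F)" using A sets_F_subset_infinity[OF t] by auto
  note int = expectation_maturity(1)[OF W \<zeta> t]
  have "(\<integral>\<omega>. indicator A \<omega> * continuation W \<zeta> t \<omega> \<partial>M) = (\<integral>\<omega>. indicator A \<omega> * W (t + \<zeta> \<omega>) \<omega> \<partial>M)"
    unfolding continuation_def
    by (rule sub.real_cond_exp_intg(2)[OF maturity_integrable[OF W \<zeta> t A']])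
       (use A borel_measurable_integrable[OF int] in auto)
  then show ?thesis using maturity_integral[OF W \<zeta> t A'] by simp
qed

text \<open>
  On an event \<open>B\<close> of \<open>F\<^sub>t\<close> and at a frozen time \<open>u \<ge> t\<close>, the integral of \<open>\<bar>W(u)\<bar>\<close> is at most that
  of \<open>M\<^sup>Y(u)\<close>, which is that of \<open>M\<^sup>Y(t)\<close>.  Averaging over \<open>u = t + \<zeta>\<close> therefore never evaluates
  \<open>M\<^sup>Y\<close> at a random time.
\<close>

lemma continuation_abs_le:
  assumes W: "dominated W" and \<zeta>: "\<zeta> \<in> randomized_maturities M F" and t: "0 \<le> t"
  shows "AE \<omega> in M. \<bar>continuation W \<zeta> t \<omega>\<bar> \<le> MY t \<omega>"
proof -
  have top: "space M \<in> sets (F t)" using sets.top[of "F t"] by simp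
  have both: "(\<integral>\<omega>. indicator B \<omega> * continuation W \<zeta> t \<omega> \<partial>M) \<le> (\<integral>\<omega>. indicator B \<omega> * MY t \<omega> \<partial>M)"
    "- (\<integral>\<omega>. indicator B \<omega> * MY t \<omega> \<partial>M) \<le> (\<integral>\<omega>. indicator B \<omega> * continuation W \<zeta> t \<omega> \<partial>M)"
    if B: "B \<in> sets (F t)" for B
  proof -
    let ?c = "\<integral>\<omega>. indicator B \<omega> * MY t \<omega> \<partial>M"
    have BM: "B \<in> sets M" and Binf: "B \<in> sets (F_infinity M F)"
      using B sets_F_subset sets_F_subset_infinity[OF t] by auto
    have inner: "\<bar>\<integral>\<omega>. indicator B \<omega> * W u \<omega> \<partial>M\<bar> \<le> ?c" if u: "t \<le> u" for u
    proof -
      have u0: "0 \<le> u" using t u by simp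
      have int: "integrable M (\<lambda>\<omega>. indicator B \<omega> * W u \<omega>)" "integrable M (\<lambda>\<omega>. indicator B \<omega> * MY u \<omega>)"
        using integrable_mult_indicator[OF BM dominated_integrable[OF W u0]]
          integrable_mult_indicator[OF BM bound_integrable[OF u0]] by simp_all
      have "\<bar>\<integral>\<omega>. indicator B \<omega> * W u \<omega> \<partial>M\<bar> \<le> (\<integral>\<omega>. \<bar>indicator B \<omega> * W u \<omega>\<bar> \<partial>M)"
        by (rule integral_abs_bound)
      also have "\<dots> \<le> (\<integral>\<omega>. indicator B \<omega> * MY u \<omega> \<partial>M)"
      proof (rule integral_mono_AE)
        show "AE \<omega> in M. \<bar>indicator B \<omega> * W u \<omega>\<bar> \<le> indicator B \<omega> * MY u \<omega>"
          using dominated_AE[OF W u0] by eventually_elim (simp add: indicator_def)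
      qed (use int in auto)
      also have "\<dots> = ?c" by (rule bound_integral[OF t u B])
      finally show ?thesis .
    qed
    have inner': "\<bar>\<integral>\<omega>. indicator B \<omega> * W (t + \<zeta> \<omega>') \<omega> \<partial>M\<bar> \<le> ?c" if "\<omega>' \<in> space M" for \<omega>'
      using randomized_maturity_nonneg[OF \<zeta> that] by (intro inner) simp
    note eq = continuation_integral[OF W \<zeta> t B] and int = averaged_integrable[OF W \<zeta> t Binf]
    show "(\<integral>\<omega>. indicator B \<omega> * continuation W \<zeta> t \<omega> \<partial>M) \<le> ?c"
      unfolding eq by (rule integral_le_const[OF int], rule AE_I2, drule inner', linarith)
    show "- ?c \<le> (\<integral>\<omega>. indicator B \<omega> * continuation W \<zeta> t \<omega> \<partial>M)"
      unfolding eq by (rule integral_ge_const[OF int], rule AE_I2, drule inner', linarith)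
  qed
  note X = continuation_measurable[of W \<zeta> t] continuation_integrable[OF W \<zeta> t]
  note B = bound_measurable[OF t] bound_integrable[OF t]
  have "AE \<omega> in M. \<omega> \<in> space M \<longrightarrow> continuation W \<zeta> t \<omega> \<le> MY t \<omega>"
    by (rule AE_le_on_of_integral_le[OF X B top]) (rule both)
  moreover have "AE \<omega> in M. \<omega> \<in> space M \<longrightarrow> - MY t \<omega> \<le> continuation W \<zeta> t \<omega>"
    by (rule AE_le_on_of_integral_le[OF _ _ X top]) (use B both(2) in auto)
  moreover have "AE \<omega> in M. \<omega> \<in> space M" by (rule AE_space)
  ultimately show ?thesis by eventually_elim auto
qed

text \<open>
  Like the previous bound, a comparison at each deterministic time is enough: the integrals over
  sub-events of \<open>A\<close> are compared at a frozen maturity.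
\<close>

lemma continuation_mono_on:
  assumes W: "dominated W" "dominated W'" and \<zeta>: "\<zeta> \<in> randomized_maturities M F" and t: "0 \<le> t"
    and A: "A \<in> sets (F t)"
    and le: "\<And>u. t \<le> u \<Longrightarrow> AE \<omega> in M. \<omega> \<in> A \<longrightarrow> W u \<omega> \<le> W' u \<omega>"
  shows "AE \<omega> in M. \<omega> \<in> A \<longrightarrow> continuation W \<zeta> t \<omega> \<le> continuation W' \<zeta> t \<omega>"
proof (rule AE_le_on_of_integral_le[OF continuation_measurable continuation_integrable[OF W(1) \<zeta> t]
      continuation_measurable continuation_integrable[OF W(2) \<zeta> t] A])
  fix B assume B: "B \<in> sets (F t)" "B \<subseteq> A"
  have BM: "B \<in> sets M" and Binf: "B \<in> sets (F_infinity M F)"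
    using B sets_F_subset sets_F_subset_infinity[OF t] by auto
  show "(\<integral>\<omega>. indicator B \<omega> * continuation W \<zeta> t \<omega> \<partial>M) \<le> (\<integral>\<omega>. indicator B \<omega> * continuation W' \<zeta> t \<omega> \<partial>M)"
    unfolding continuation_integral[OF W(1) \<zeta> t B(1)] continuation_integral[OF W(2) \<zeta> t B(1)]
  proof (rule integral_mono[OF averaged_integrable[OF W(1) \<zeta> t Binf] averaged_integrable[OF W(2) \<zeta> t Binf]])
    fix \<omega>' assume "\<omega>' \<in> space M"
    then have u: "t \<le> t + \<zeta> \<omega>'" using randomized_maturity_nonneg[OF \<zeta>] by simp
    then have u0: "0 \<le> t + \<zeta> \<omega>'" using t by simp
    show "(\<integral>\<omega>. indicator B \<omega> * W (t + \<zeta> \<omega>') \<omega> \<partial>M) \<le> (\<integral>\<omega>. indicator B \<omega> * W' (t + \<zeta> \<omega>') \<omega> \<partial>M)"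
    proof (rule integral_mono_AE)
      show "AE \<omega> in M. indicator B \<omega> * W (t + \<zeta> \<omega>') \<omega> \<le> indicator B \<omega> * W' (t + \<zeta> \<omega>') \<omega>"
        using le[OF u] by eventually_elim (use B(2) in \<open>auto simp: indicator_def\<close>)
    qed (use integrable_mult_indicator[OF BM dominated_integrable[OF W(1) u0]]
          integrable_mult_indicator[OF BM dominated_integrable[OF W(2) u0]] in simp_all)
  qed
qed

end

section \<open>Pasting and directedness of the algorithm\<close>

lemma agree_before_sym: "agree_before M t \<mu> \<nu> \<Longrightarrow> agree_before M t \<nu> \<mu>"
  unfolding agree_before_def by (auto elim: eventually_mono)

lemma agree_before_trans:
  "agree_before M t \<mu> \<nu> \<Longrightarrow> agree_before M t \<nu> \<kappa> \<Longrightarrow> agree_before M t \<mu> \<kappa>"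
  unfolding agree_before_def by (auto elim: eventually_elim2)

lemma agree_before_mono: "agree_before M t \<mu> \<nu> \<Longrightarrow> s \<le> t \<Longrightarrow> agree_before M s \<mu> \<nu>"
  unfolding agree_before_def by (auto elim: eventually_mono)

lemma agree_before_paste:
  "agree_before M t \<mu>\<^sub>1 \<nu>\<^sub>1 \<Longrightarrow> agree_before M t \<mu>\<^sub>2 \<nu>\<^sub>2 \<Longrightarrow> agree_before M t (paste A \<mu>\<^sub>1 \<mu>\<^sub>2) (paste A \<nu>\<^sub>1 \<nu>\<^sub>2)"
  unfolding agree_before_def paste_def by (auto elim: eventually_elim2)

lemma paste_same: "paste A \<nu> \<nu> = \<nu>"
  unfolding paste_def by simp

locale maturity_algorithm = martingale_bound M F MY
  for M :: "'a measure" and F and MY +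
  fixes Adm :: "('a, 'd::finite) control set"
    and Y :: "('a, 'd) control \<Rightarrow> real \<Rightarrow> 'a \<Rightarrow> real"
    and \<zeta> :: "nat \<Rightarrow> nat \<Rightarrow> 'a \<Rightarrow> real"
    and V Vbar :: "nat \<Rightarrow> nat \<Rightarrow> ('a, 'd) control \<Rightarrow> real \<Rightarrow> 'a \<Rightarrow> real"
  assumes state_progressive: "\<nu> \<in> Adm \<Longrightarrow> progressively_measurable F (Y \<nu>)"
    and state_bound: "\<nu> \<in> Adm \<Longrightarrow> AE \<omega> in M. \<forall>t\<ge>0. \<bar>Y \<nu> t \<omega>\<bar> \<le> MY t \<omega>"
    and maturities: "1 \<le> n \<Longrightarrow> k \<in> {1..n} \<Longrightarrow> \<zeta> n k \<in> randomized_maturities M F"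
    and maturities_indep: "1 \<le> n \<Longrightarrow> indep_vars (\<lambda>_. borel) (\<zeta> n) {1..n}"
    and algorithm: "algorithm M F Adm Y \<zeta> V Vbar"
    and HV: "HV M F Adm V Vbar"
    and HU: "HU M F Adm"
begin

lemma state_dominated:
  assumes "\<nu> \<in> Adm"
  shows "dominated (Y \<nu>)"
  unfolding dominated_def
proof (intro conjI allI impI)
  show "jointly_measurable (Y \<nu>)"
    by (rule progressively_measurable_imp_jointly_measurable[OF state_progressive[OF assms]])
  show "AE \<omega> in M. \<bar>Y \<nu> t \<omega>\<bar> \<le> MY t \<omega>" if "0 \<le> t" for t
    using state_bound[OF assms] by eventually_elim (use that in blast)
qed

lemma admissible_fromD: "\<mu> \<in> admissible_from M Adm t \<nu> \<Longrightarrow> \<mu> \<in> Adm"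
  "\<mu> \<in> admissible_from M Adm t \<nu> \<Longrightarrow> agree_before M t \<mu> \<nu>"
  unfolding admissible_from_def by auto

lemma admissible_from_self: "\<nu> \<in> Adm \<Longrightarrow> \<nu> \<in> admissible_from M Adm t \<nu>"
  unfolding admissible_from_def agree_before_def by simp

lemma admissible_from_0: "admissible_from M Adm 0 \<nu> = Adm"
  unfolding admissible_from_def agree_before_def by simp

abbreviation cont_value :: "nat \<Rightarrow> nat \<Rightarrow> ('a, 'd) control \<Rightarrow> real \<Rightarrow> 'a \<Rightarrow> real" where
  "cont_value n k \<mu> t \<equiv> continuation (Vbar n k \<mu>) (\<zeta> n (n - k)) t"

context
  fixes n :: nat
  assumes n: "1 \<le> n"
begin

lemma maturity: "k < n \<Longrightarrow> \<zeta> n (n - k) \<in> randomized_maturities M F"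
  using n by (intro maturities) auto

lemma Vbar_0: "\<nu> \<in> Adm \<Longrightarrow> Vbar n 0 \<nu> = Y \<nu>"
  using algorithm n unfolding algorithm_def by metis

lemma is_ess_sup_V:
  assumes "\<nu> \<in> Adm" "k < n" "0 \<le> t"
  shows "is_ess_sup M ((\<lambda>\<mu>. cont_value n k \<mu> t) ` admissible_from M Adm t \<nu>) (V n (Suc k) \<nu> t)"
  using algorithm n assms unfolding algorithm_def continuation_def image_def
  by (simp add: Bex_def conj_commute)

lemma Vbar_AE_V:
  assumes "\<nu> \<in> Adm" "Suc k < n" "0 \<le> t"
  shows "AE \<omega> in M. Vbar n (Suc k) \<nu> t \<omega> = V n (Suc k) \<nu> t \<omega>"
  using HV n assms unfolding HV_def by auto

lemma Vbar_jointly_measurable: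
  assumes "\<nu> \<in> Adm" "Suc k < n"
  shows "jointly_measurable (Vbar n (Suc k) \<nu>)"
  using HV n assms unfolding HV_def jointly_measurable_def by auto

lemma V_ge_cont_value:
  assumes "\<nu> \<in> Adm" "k < n" "0 \<le> t" "\<mu> \<in> admissible_from M Adm t \<nu>"
  shows "AE \<omega> in M. cont_value n k \<mu> t \<omega> \<le> V n (Suc k) \<nu> t \<omega>"
  by (rule is_ess_sup_upper[OF is_ess_sup_V[OF assms(1-3)]]) (use assms(4) in simp)

text \<open>
  The upper bound is inherited by the essential supremum; for the lower one the continuation value of
  \<open>\<nu>\<close> itself is a competitor.
\<close>

lemma Vbar_dominated:
  assumes "k < n" "\<nu> \<in> Adm"
  shows "dominated (Vbar n k \<nu>)"
  using assms
proof (induction k arbitrary: \<nu>)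
  case 0
  then show ?case using state_dominated Vbar_0 by simp
next
  case (Suc k)
  then have k: "k < n" by simp
  show ?case unfolding dominated_def
  proof (intro conjI allI impI)
    show "jointly_measurable (Vbar n (Suc k) \<nu>)" using Suc.prems by (intro Vbar_jointly_measurable)
    fix t :: real assume t: "0 \<le> t"
    have bnd: "AE \<omega> in M. \<bar>cont_value n k \<mu> t \<omega>\<bar> \<le> MY t \<omega>" if "\<mu> \<in> Adm" for \<mu>
      by (rule continuation_abs_le[OF Suc.IH[OF k that] maturity[OF k] t])
    have "AE \<omega> in M. V n (Suc k) \<nu> t \<omega> \<le> MY t \<omega>"
    proof (rule is_ess_sup_least[OF is_ess_sup_V[OF Suc.prems(2) k t]])
      show "MY t \<in> borel_measurable M" using bound_integrable[OF t] by simp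
      fix X assume "X \<in> (\<lambda>\<mu>. cont_value n k \<mu> t) ` admissible_from M Adm t \<nu>"
      then obtain \<mu> where \<mu>: "X = cont_value n k \<mu> t" "\<mu> \<in> Adm" using admissible_fromD(1) by blast
      show "AE \<omega> in M. X \<omega> \<le> MY t \<omega>" unfolding \<mu>(1) using bnd[OF \<mu>(2)] by eventually_elim simp
    qed
    then show "AE \<omega> in M. \<bar>Vbar n (Suc k) \<nu> t \<omega>\<bar> \<le> MY t \<omega>"
      using Vbar_AE_V[OF Suc.prems(2,1) t] bnd[OF Suc.prems(2)]
        V_ge_cont_value[OF Suc.prems(2) k t admissible_from_self[OF Suc.prems(2)]]
      by eventually_elim auto
  qed
qed

lemma cont_value_integrable:
  assumes "k < n" "\<mu> \<in> Adm" "0 \<le> t"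
  shows "integrable M (cont_value n k \<mu> t)"
  by (rule continuation_integrable[OF Vbar_dominated[OF assms(1,2)] maturity[OF assms(1)] assms(3)])

lemma paste_admissible:
  assumes "\<nu>\<^sub>1 \<in> Adm" "\<nu>\<^sub>2 \<in> Adm" "0 \<le> t" "A \<in> sets (F t)" "agree_before M t \<nu>\<^sub>1 \<nu>\<^sub>2"
  shows "paste A \<nu>\<^sub>1 \<nu>\<^sub>2 \<in> Adm"
  using HU assms unfolding HU_def by blast

text \<open>
  Pasting a competitor of \<open>\<nu>\<^sub>1\<close> with \<open>\<nu>\<^sub>2\<close>, or \<open>\<nu>\<^sub>1\<close> with a competitor of \<open>\<nu>\<^sub>2\<close>, gives a competitor
  of the pasted control.  By induction its continuation value is not smaller on \<open>A\<close>, respectively on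
  the complement of \<open>A\<close>, so the essential suprema compare there.
\<close>

lemma Vbar_le_paste:
  assumes resp: "state_respects_pasting M F Adm Y"
    and "k < n" "\<nu>\<^sub>1 \<in> Adm" "\<nu>\<^sub>2 \<in> Adm" "0 \<le> t" "A \<in> sets (F t)" "agree_before M t \<nu>\<^sub>1 \<nu>\<^sub>2" "t \<le> s"
  shows "AE \<omega> in M. (if \<omega> \<in> A then Vbar n k \<nu>\<^sub>1 s \<omega> else Vbar n k \<nu>\<^sub>2 s \<omega>) \<le> Vbar n k (paste A \<nu>\<^sub>1 \<nu>\<^sub>2) s \<omega>"
  using assms(2-)
proof (induction k arbitrary: \<nu>\<^sub>1 \<nu>\<^sub>2 s)
  case 0
  have "AE \<omega> in M. Y (paste A \<nu>\<^sub>1 \<nu>\<^sub>2) s \<omega> = (if \<omega> \<in> A then Y \<nu>\<^sub>1 s \<omega> else Y \<nu>\<^sub>2 s \<omega>)"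
    using resp 0 unfolding state_respects_pasting_def by simp
  then show ?case
    unfolding Vbar_0[OF 0(2)] Vbar_0[OF 0(3)] Vbar_0[OF paste_admissible[OF 0(2-6)]]
    by eventually_elim simp
next
  case (Suc k)
  note adm = Suc.prems(2,3) and t = Suc.prems(4) and A = Suc.prems(5) and agree = Suc.prems(6) and s = Suc.prems(7)
  let ?\<pi> = "paste A \<nu>\<^sub>1 \<nu>\<^sub>2"
  have k: "k < n" and s0: "0 \<le> s" using Suc.prems by auto
  have \<pi>: "?\<pi> \<in> Adm" by (rule paste_admissible[OF adm t A agree])
  have As: "A \<in> sets (F s)" using A sets_F_mono[OF s] by auto
  have Ac: "space M - A \<in> sets (F s)" using As sets.compl_sets[OF As] by simp
  have AM: "A \<in> sets M" "space M - A \<in> sets M" using As Ac sets_F_subset by auto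
  have "AE \<omega> in M. \<omega> \<in> A \<longrightarrow> V n (Suc k) \<nu>\<^sub>1 s \<omega> \<le> V n (Suc k) ?\<pi> s \<omega>"
  proof (rule ess_sup_le_on[OF is_ess_sup_V[OF adm(1) k s0] is_ess_sup_V[OF \<pi> k s0] AM(1)])
    fix X assume "X \<in> (\<lambda>\<mu>. cont_value n k \<mu> s) ` admissible_from M Adm s \<nu>\<^sub>1"
    then obtain \<mu> where X: "X = cont_value n k \<mu> s" and \<mu>: "\<mu> \<in> admissible_from M Adm s \<nu>\<^sub>1" by blast
    have \<mu>2: "agree_before M t \<mu> \<nu>\<^sub>2"
      by (rule agree_before_trans[OF agree_before_mono[OF admissible_fromD(2)[OF \<mu>] s] agree])
    note \<kappa> = paste_admissible[OF admissible_fromD(1)[OF \<mu>] adm(2) t A \<mu>2]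
    have "AE \<omega> in M. \<omega> \<in> A \<longrightarrow> cont_value n k \<mu> s \<omega> \<le> cont_value n k (paste A \<mu> \<nu>\<^sub>2) s \<omega>"
    proof (rule continuation_mono_on[OF Vbar_dominated[OF k admissible_fromD(1)[OF \<mu>]]
          Vbar_dominated[OF k \<kappa>] maturity[OF k] s0 As])
      fix u assume "s \<le> u"
      with s have "t \<le> u" by simp
      from Suc.IH[OF k admissible_fromD(1)[OF \<mu>] adm(2) t A \<mu>2 this]
      show "AE \<omega> in M. \<omega> \<in> A \<longrightarrow> Vbar n k \<mu> u \<omega> \<le> Vbar n k (paste A \<mu> \<nu>\<^sub>2) u \<omega>"
        by eventually_elim auto
    qed
    moreover have "paste A \<mu> \<nu>\<^sub>2 \<in> admissible_from M Adm s ?\<pi>"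
      using \<kappa> agree_before_paste[OF admissible_fromD(2)[OF \<mu>] admissible_fromD(2)[OF admissible_from_self[OF adm(2)]]]
      unfolding admissible_from_def by simp
    ultimately show "\<exists>X'\<in>(\<lambda>\<mu>. cont_value n k \<mu> s) ` admissible_from M Adm s ?\<pi>.
        AE \<omega> in M. \<omega> \<in> A \<longrightarrow> X \<omega> \<le> X' \<omega>"
      unfolding X by (intro bexI[OF _ imageI])
  qed
  moreover have "AE \<omega> in M. \<omega> \<in> space M - A \<longrightarrow> V n (Suc k) \<nu>\<^sub>2 s \<omega> \<le> V n (Suc k) ?\<pi> s \<omega>"
  proof (rule ess_sup_le_on[OF is_ess_sup_V[OF adm(2) k s0] is_ess_sup_V[OF \<pi> k s0] AM(2)])
    fix X assume "X \<in> (\<lambda>\<mu>. cont_value n k \<mu> s) ` admissible_from M Adm s \<nu>\<^sub>2"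
    then obtain \<mu> where X: "X = cont_value n k \<mu> s" and \<mu>: "\<mu> \<in> admissible_from M Adm s \<nu>\<^sub>2" by blast
    have \<mu>1: "agree_before M t \<nu>\<^sub>1 \<mu>"
      by (rule agree_before_trans[OF agree agree_before_sym[OF agree_before_mono[OF admissible_fromD(2)[OF \<mu>] s]]])
    note \<kappa> = paste_admissible[OF adm(1) admissible_fromD(1)[OF \<mu>] t A \<mu>1]
    have "AE \<omega> in M. \<omega> \<in> space M - A \<longrightarrow> cont_value n k \<mu> s \<omega> \<le> cont_value n k (paste A \<nu>\<^sub>1 \<mu>) s \<omega>"
    proof (rule continuation_mono_on[OF Vbar_dominated[OF k admissible_fromD(1)[OF \<mu>]]
          Vbar_dominated[OF k \<kappa>] maturity[OF k] s0 Ac])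
      fix u assume "s \<le> u"
      with s have "t \<le> u" by simp
      from Suc.IH[OF k adm(1) admissible_fromD(1)[OF \<mu>] t A \<mu>1 this]
      show "AE \<omega> in M. \<omega> \<in> space M - A \<longrightarrow> Vbar n k \<mu> u \<omega> \<le> Vbar n k (paste A \<nu>\<^sub>1 \<mu>) u \<omega>"
        by eventually_elim auto
    qed
    moreover have "paste A \<nu>\<^sub>1 \<mu> \<in> admissible_from M Adm s ?\<pi>"
      using \<kappa> agree_before_paste[OF admissible_fromD(2)[OF admissible_from_self[OF adm(1)]] admissible_fromD(2)[OF \<mu>]]
      unfolding admissible_from_def by simp
    ultimately show "\<exists>X'\<in>(\<lambda>\<mu>. cont_value n k \<mu> s) ` admissible_from M Adm s ?\<pi>.
        AE \<omega> in M. \<omega> \<in> space M - A \<longrightarrow> X \<omega> \<le> X' \<omega>"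
      unfolding X by (intro bexI[OF _ imageI])
  qed
  moreover have "AE \<omega> in M. \<omega> \<in> space M" by (rule AE_space)
  ultimately show ?case
    using Vbar_AE_V[OF adm(1) Suc.prems(1) s0] Vbar_AE_V[OF adm(2) Suc.prems(1) s0]
      Vbar_AE_V[OF \<pi> Suc.prems(1) s0]
    by eventually_elim auto
qed

text \<open>
  Follow \<open>\<mu>\<^sub>1\<close> on the event, known at time \<open>t\<close>, where its continuation value is the larger one, and
  \<open>\<mu>\<^sub>2\<close> elsewhere.
\<close>

lemma cont_values_directed:
  assumes resp: "state_respects_pasting M F Adm Y"
    and k: "k < n" and t: "0 \<le> t"
    and \<mu>\<^sub>1: "\<mu>\<^sub>1 \<in> admissible_from M Adm t \<nu>" and \<mu>\<^sub>2: "\<mu>\<^sub>2 \<in> admissible_from M Adm t \<nu>"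
  shows "\<exists>\<mu>\<in>admissible_from M Adm t \<nu>.
    AE \<omega> in M. max (cont_value n k \<mu>\<^sub>1 t \<omega>) (cont_value n k \<mu>\<^sub>2 t \<omega>) \<le> cont_value n k \<mu> t \<omega>"
proof -
  define A where "A = {\<omega> \<in> space (F t). cont_value n k \<mu>\<^sub>2 t \<omega> \<le> cont_value n k \<mu>\<^sub>1 t \<omega>}"
  have A: "A \<in> sets (F t)"
    unfolding A_def by (rule borel_measurable_le[OF continuation_measurable continuation_measurable])
  then have Ac: "space M - A \<in> sets (F t)" using sets.compl_sets[OF A] by simp
  note adm = admissible_fromD(1)[OF \<mu>\<^sub>1] admissible_fromD(1)[OF \<mu>\<^sub>2]
  have agree: "agree_before M t \<mu>\<^sub>1 \<mu>\<^sub>2"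
    by (rule agree_before_trans[OF admissible_fromD(2)[OF \<mu>\<^sub>1] agree_before_sym[OF admissible_fromD(2)[OF \<mu>\<^sub>2]]])
  note \<kappa> = paste_admissible[OF adm t A agree]
  note le = Vbar_le_paste[OF resp k adm t A agree]
  have "AE \<omega> in M. \<omega> \<in> A \<longrightarrow> cont_value n k \<mu>\<^sub>1 t \<omega> \<le> cont_value n k (paste A \<mu>\<^sub>1 \<mu>\<^sub>2) t \<omega>"
  proof (rule continuation_mono_on[OF Vbar_dominated[OF k adm(1)] Vbar_dominated[OF k \<kappa>] maturity[OF k] t A])
    show "AE \<omega> in M. \<omega> \<in> A \<longrightarrow> Vbar n k \<mu>\<^sub>1 u \<omega> \<le> Vbar n k (paste A \<mu>\<^sub>1 \<mu>\<^sub>2) u \<omega>" if "t \<le> u" for u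
      using le[OF that] by eventually_elim auto
  qed
  moreover have "AE \<omega> in M. \<omega> \<in> space M - A \<longrightarrow> cont_value n k \<mu>\<^sub>2 t \<omega> \<le> cont_value n k (paste A \<mu>\<^sub>1 \<mu>\<^sub>2) t \<omega>"
  proof (rule continuation_mono_on[OF Vbar_dominated[OF k adm(2)] Vbar_dominated[OF k \<kappa>] maturity[OF k] t Ac])
    show "AE \<omega> in M. \<omega> \<in> space M - A \<longrightarrow> Vbar n k \<mu>\<^sub>2 u \<omega> \<le> Vbar n k (paste A \<mu>\<^sub>1 \<mu>\<^sub>2) u \<omega>" if "t \<le> u" for u
      using le[OF that] by eventually_elim auto
  qed
  moreover have "AE \<omega> in M. \<omega> \<in> space M" by (rule AE_space)
  ultimately have "AE \<omega> in M. max (cont_value n k \<mu>\<^sub>1 t \<omega>) (cont_value n k \<mu>\<^sub>2 t \<omega>) \<le> cont_value n k (paste A \<mu>\<^sub>1 \<mu>\<^sub>2) t \<omega>"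
    by eventually_elim (auto simp: A_def)
  moreover have "paste A \<mu>\<^sub>1 \<mu>\<^sub>2 \<in> admissible_from M Adm t \<nu>"
    using \<kappa> agree_before_paste[OF admissible_fromD(2)[OF \<mu>\<^sub>1] admissible_fromD(2)[OF \<mu>\<^sub>2], of A]
    unfolding admissible_from_def paste_same by simp
  ultimately show ?thesis by blast
qed

lemma Vbar_integral_le:
  assumes resp: "state_respects_pasting M F Adm Y"
    and k: "Suc k < n" and \<nu>: "\<nu> \<in> Adm" and t: "0 \<le> t"
    and le: "\<And>\<mu>. \<mu> \<in> admissible_from M Adm t \<nu> \<Longrightarrow> (\<integral>\<omega>. cont_value n k \<mu> t \<omega> \<partial>M) \<le> c"
  shows "(\<integral>\<omega>. Vbar n (Suc k) \<nu> t \<omega> \<partial>M) \<le> c"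
proof -
  let ?XX = "(\<lambda>\<mu>. cont_value n k \<mu> t) ` admissible_from M Adm t \<nu>"
  have k': "k < n" using k by simp
  note S = is_ess_sup_V[OF \<nu> k' t]
  have "(\<integral>\<omega>. V n (Suc k) \<nu> t \<omega> \<partial>M) \<le> c"
  proof (rule integral_ess_sup_le_of_directed[OF S])
    show "?XX \<noteq> {}" using admissible_from_self[OF \<nu>] by blast
    show "integrable M (MY t)" by (rule bound_integrable[OF t])
    show "integrable M X" "AE \<omega> in M. \<bar>X \<omega>\<bar> \<le> MY t \<omega>" "(\<integral>\<omega>. X \<omega> \<partial>M) \<le> c" if "X \<in> ?XX" for X
      using that cont_value_integrable[OF k' admissible_fromD(1) t] le
        continuation_abs_le[OF Vbar_dominated[OF k' admissible_fromD(1)] maturity[OF k'] t] by auto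
    show "\<exists>Z\<in>?XX. AE \<omega> in M. max (X \<omega>) (X' \<omega>) \<le> Z \<omega>" if XX: "X \<in> ?XX" "X' \<in> ?XX" for X X'
    proof -
      obtain \<mu> \<mu>' where \<mu>: "X = cont_value n k \<mu> t" "\<mu> \<in> admissible_from M Adm t \<nu>"
        "X' = cont_value n k \<mu>' t" "\<mu>' \<in> admissible_from M Adm t \<nu>" using XX by blast
      show ?thesis unfolding \<mu>(1,3)
        using cont_values_directed[OF resp k' t \<mu>(2,4)] by (rule bexE) (rule bexI[OF _ imageI])
    qed
  qed
  also have "(\<integral>\<omega>. V n (Suc k) \<nu> t \<omega> \<partial>M) = (\<integral>\<omega>. Vbar n (Suc k) \<nu> t \<omega> \<partial>M)"
  proof (rule integral_cong_AE)
    show "AE \<omega> in M. V n (Suc k) \<nu> t \<omega> = Vbar n (Suc k) \<nu> t \<omega>"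
      using Vbar_AE_V[OF \<nu> k t] by eventually_elim simp
    show "V n (Suc k) \<nu> t \<in> borel_measurable M" using S unfolding is_ess_sup_def by simp
    show "Vbar n (Suc k) \<nu> t \<in> borel_measurable M" using dominated_integrable[OF Vbar_dominated[OF k \<nu>] t] by simp
  qed
  finally show ?thesis .
qed

lemma cont_value_integral_le_Vbar:
  assumes k: "Suc k < n" and \<nu>: "\<nu> \<in> Adm" and t: "0 \<le> t"
  shows "(\<integral>\<omega>. cont_value n k \<nu> t \<omega> \<partial>M) \<le> (\<integral>\<omega>. Vbar n (Suc k) \<nu> t \<omega> \<partial>M)"
proof (rule integral_mono_AE)
  have k': "k < n" using k by simp
  show "AE \<omega> in M. cont_value n k \<nu> t \<omega> \<le> Vbar n (Suc k) \<nu> t \<omega>"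
    using V_ge_cont_value[OF \<nu> k' t admissible_from_self[OF \<nu>]] Vbar_AE_V[OF \<nu> k t]
    by eventually_elim simp
  show "integrable M (cont_value n k \<nu> t)" by (rule cont_value_integrable[OF k' \<nu> t])
  show "integrable M (Vbar n (Suc k) \<nu> t)" by (rule dominated_integrable[OF Vbar_dominated[OF k \<nu>] t])
qed

end

section \<open>Bounds on the algorithm by means at tail sums of maturities\<close>

text \<open>
  The time consumed by the first \<open>k\<close> steps of the algorithm, which uses the maturities of a row in
  decreasing order of their index.
\<close>

definition tail_maturity :: "nat \<Rightarrow> nat \<Rightarrow> 'a \<Rightarrow> real" where
  "tail_maturity n k \<omega> = (\<Sum>j\<in>{n - k<..n}. \<zeta> n j \<omega>)"

lemma tail_maturity_0: "tail_maturity n 0 \<omega> = 0"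
  by (simp add: tail_maturity_def)

lemma tail_maturity_all: "tail_maturity n n = total_maturity \<zeta> n"
proof
  fix \<omega>
  have "{0<..n} = {1..n}" by auto
  then show "tail_maturity n n \<omega> = total_maturity \<zeta> n \<omega>"
    by (simp add: tail_maturity_def total_maturity_def)
qed

lemma integral_tail_maturity_Suc:
  fixes \<phi> :: "real \<Rightarrow> real"
  assumes k: "k < n" and \<phi>: "\<phi> \<in> borel_measurable borel" "\<And>x. \<bar>\<phi> x\<bar> \<le> C"
  shows "integrable M (\<lambda>\<omega>'. \<integral>\<omega>. \<phi> (t + \<zeta> n (n - k) \<omega>' + tail_maturity n k \<omega>) \<partial>M)"
    and "(\<integral>\<omega>. \<phi> (t + tail_maturity n (Suc k) \<omega>) \<partial>M)
      = (\<integral>\<omega>'. \<integral>\<omega>. \<phi> (t + \<zeta> n (n - k) \<omega>' + tail_maturity n k \<omega>) \<partial>M \<partial>M)"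
proof -
  have split: "{n - Suc k<..n} = insert (n - k) {n - k<..n}" using k by auto
  have "indep_vars (\<lambda>_. borel) (\<zeta> n) (insert (n - k) {n - k<..n})"
    by (rule indep_vars_subset[OF maturities_indep]) (use k in auto)
  then have ind: "indep_var borel (\<zeta> n (n - k)) borel (tail_maturity n k)"
    unfolding tail_maturity_def by (intro indep_vars_sum) auto
  have [measurable]: "(\<lambda>x. \<phi> (t + x)) \<in> borel_measurable borel"
    using \<phi>(1) by measurable
  note add = integral_add_indep_var[where \<phi> = "\<lambda>x. \<phi> (t + x)", OF ind this \<phi>(2)]
  have "tail_maturity n (Suc k) \<omega> = \<zeta> n (n - k) \<omega> + tail_maturity n k \<omega>" for \<omega>
    unfolding tail_maturity_def split by simp
  then show "integrable M (\<lambda>\<omega>'. \<integral>\<omega>. \<phi> (t + \<zeta> n (n - k) \<omega>' + tail_maturity n k \<omega>) \<partial>M)"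
    and "(\<integral>\<omega>. \<phi> (t + tail_maturity n (Suc k) \<omega>) \<partial>M)
      = (\<integral>\<omega>'. \<integral>\<omega>. \<phi> (t + \<zeta> n (n - k) \<omega>' + tail_maturity n k \<omega>) \<partial>M \<partial>M)"
    using add by (simp_all add: add.assoc)
qed

lemma total_maturity_measurable: "total_maturity \<zeta> n \<in> borel_measurable M"
  unfolding total_maturity_def
  by (intro borel_measurable_sum randomized_maturity_measurable maturities) auto

lemma total_maturity_nonneg: "\<omega> \<in> space M \<Longrightarrow> 0 \<le> total_maturity \<zeta> n \<omega>"
  unfolding total_maturity_def
  by (intro sum_nonneg randomized_maturity_nonneg maturities) auto

lemma cont_value_expectation:
  assumes "k < n" "\<mu> \<in> Adm" "0 \<le> t"
  shows "integrable M (\<lambda>\<omega>'. \<integral>\<omega>. Vbar n k \<mu> (t + \<zeta> n (n - k) \<omega>') \<omega> \<partial>M)"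
    and "(\<integral>\<omega>. cont_value n k \<mu> t \<omega> \<partial>M) = (\<integral>\<omega>'. \<integral>\<omega>. Vbar n k \<mu> (t + \<zeta> n (n - k) \<omega>') \<omega> \<partial>M \<partial>M)"
proof -
  have n: "1 \<le> n" using assms(1) by simp
  note D = Vbar_dominated[OF n assms(1,2)] maturity[OF n assms(1)] assms(3)
  show "integrable M (\<lambda>\<omega>'. \<integral>\<omega>. Vbar n k \<mu> (t + \<zeta> n (n - k) \<omega>') \<omega> \<partial>M)"
    by (rule expectation_maturity(2)[OF D])
  show "(\<integral>\<omega>. cont_value n k \<mu> t \<omega> \<partial>M) = (\<integral>\<omega>'. \<integral>\<omega>. Vbar n k \<mu> (t + \<zeta> n (n - k) \<omega>') \<omega> \<partial>M \<partial>M)"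
    by (rule continuation_expectation[OF D])
qed

lemma shifted_nonneg: "k < n \<Longrightarrow> 0 \<le> t \<Longrightarrow> \<omega> \<in> space M \<Longrightarrow> 0 \<le> t + \<zeta> n (n - k) \<omega>"
  using randomized_maturity_nonneg[OF maturity] by (simp add: add_nonneg_nonneg)

text \<open>
  One step of the algorithm adds one independent maturity: averaging the mean of the iterate over
  \<open>\<zeta> n (n - k)\<close> prolongs the tail sum by one term.
\<close>

lemma cont_value_integral_le:
  assumes k: "k < n" and \<mu>: "\<mu> \<in> Adm" and t: "0 \<le> t"
    and h: "h \<in> borel_measurable borel" "\<And>x. \<bar>h x\<bar> \<le> C"
    and le: "\<And>u. 0 \<le> u \<Longrightarrow> (\<integral>\<omega>. Vbar n k \<mu> u \<omega> \<partial>M) \<le> (\<integral>\<omega>. h (u + tail_maturity n k \<omega>) \<partial>M)"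
  shows "(\<integral>\<omega>. cont_value n k \<mu> t \<omega> \<partial>M) \<le> (\<integral>\<omega>. h (t + tail_maturity n (Suc k) \<omega>) \<partial>M)"
  unfolding cont_value_expectation(2)[OF k \<mu> t] integral_tail_maturity_Suc(2)[OF k h]
  by (rule integral_mono[OF cont_value_expectation(1)[OF k \<mu> t] integral_tail_maturity_Suc(1)[OF k h]])
     (rule le[OF shifted_nonneg[OF k t]])

lemma cont_value_integral_ge:
  assumes k: "k < n" and \<mu>: "\<mu> \<in> Adm" and t: "0 \<le> t"
    and \<phi>: "\<phi> \<in> borel_measurable borel" "\<And>x. \<bar>\<phi> x\<bar> \<le> C"
    and ge: "\<And>u. 0 \<le> u \<Longrightarrow> (\<integral>\<omega>. \<phi> (u + tail_maturity n k \<omega>) \<partial>M) \<le> (\<integral>\<omega>. Vbar n k \<mu> u \<omega> \<partial>M)"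
  shows "(\<integral>\<omega>. \<phi> (t + tail_maturity n (Suc k) \<omega>) \<partial>M) \<le> (\<integral>\<omega>. cont_value n k \<mu> t \<omega> \<partial>M)"
  unfolding cont_value_expectation(2)[OF k \<mu> t] integral_tail_maturity_Suc(2)[OF k \<phi>]
  by (rule integral_mono[OF integral_tail_maturity_Suc(1)[OF k \<phi>] cont_value_expectation(1)[OF k \<mu> t]])
     (rule ge[OF shifted_nonneg[OF k t]])

text \<open>
  Directedness enters here: the mean of an iterate is at most \<open>c\<close> as soon as the means of the
  competing continuation values are.
\<close>

lemma Vbar_integral_le_tail:
  assumes resp: "state_respects_pasting M F Adm Y"
    and h: "h \<in> borel_measurable borel" "\<And>x. \<bar>h x\<bar> \<le> C"
    and le: "\<And>\<nu> u. \<nu> \<in> Adm \<Longrightarrow> 0 \<le> u \<Longrightarrow> (\<integral>\<omega>. Y \<nu> u \<omega> \<partial>M) \<le> h u"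
    and "k < n" "\<nu> \<in> Adm" "0 \<le> t"
  shows "(\<integral>\<omega>. Vbar n k \<nu> t \<omega> \<partial>M) \<le> (\<integral>\<omega>. h (t + tail_maturity n k \<omega>) \<partial>M)"
  using assms(5-)
proof (induction k arbitrary: \<nu> t)
  case 0
  then show ?case using le[OF 0(2,3)] by (simp add: Vbar_0 tail_maturity_0 prob_space)
next
  case (Suc k)
  then have k: "k < n" by simp
  then have n: "1 \<le> n" by simp
  show ?case
  proof (rule Vbar_integral_le[OF n resp Suc.prems])
    fix \<mu> assume "\<mu> \<in> admissible_from M Adm t \<nu>"
    then have \<mu>: "\<mu> \<in> Adm" by (rule admissible_fromD(1))
    show "(\<integral>\<omega>. cont_value n k \<mu> t \<omega> \<partial>M) \<le> (\<integral>\<omega>. h (t + tail_maturity n (Suc k) \<omega>) \<partial>M)"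
      by (rule cont_value_integral_le[OF k \<mu> Suc.prems(3) h Suc.IH[OF k \<mu>]])
  qed
qed

text \<open>
  At every step \<open>\<mu>\<close> is its own competitor: never switching the control bounds the algorithm from below.
\<close>

lemma Vbar_integral_ge_tail:
  assumes \<phi>: "\<phi> \<in> borel_measurable borel" "\<And>x. \<bar>\<phi> x\<bar> \<le> C"
    and \<mu>: "\<mu> \<in> Adm" and ge: "\<And>u. 0 \<le> u \<Longrightarrow> \<phi> u \<le> (\<integral>\<omega>. Y \<mu> u \<omega> \<partial>M)"
    and "k < n" "0 \<le> t"
  shows "(\<integral>\<omega>. \<phi> (t + tail_maturity n k \<omega>) \<partial>M) \<le> (\<integral>\<omega>. Vbar n k \<mu> t \<omega> \<partial>M)"
  using assms(5-)
proof (induction k arbitrary: t)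
  case 0
  then show ?case using ge[OF 0(2)] \<mu> by (simp add: Vbar_0 tail_maturity_0 prob_space)
next
  case (Suc k)
  then have k: "k < n" by simp
  then have n: "1 \<le> n" by simp
  show ?case
    by (rule order_trans[OF cont_value_integral_ge[OF k \<mu> Suc.prems(2) \<phi> Suc.IH[OF k]]
          cont_value_integral_le_Vbar[OF n Suc.prems(1) \<mu> Suc.prems(2)]])
qed

text \<open>
  The last essential supremum is taken at time 0, where every continuation value is almost surely equal
  to its mean.
\<close>

definition algorithm_value :: "nat \<Rightarrow> real" where
  "algorithm_value n = (SUP \<mu>\<in>Adm. \<integral>\<omega>. cont_value n (n - 1) \<mu> 0 \<omega> \<partial>M)"

context
  fixes n :: nat
  assumes n: "1 \<le> n"
begin

lemma last_index: "n - 1 < n" "Suc (n - 1) = n"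
  using n by auto

lemma bdd_above_cont_values: "bdd_above ((\<lambda>\<mu>. \<integral>\<omega>. cont_value n (n - 1) \<mu> 0 \<omega> \<partial>M) ` Adm)"
proof (rule bdd_aboveI2)
  fix \<mu> assume \<mu>: "\<mu> \<in> Adm"
  show "(\<integral>\<omega>. cont_value n (n - 1) \<mu> 0 \<omega> \<partial>M) \<le> (\<integral>\<omega>. MY 0 \<omega> \<partial>M)"
  proof (rule integral_mono_AE[OF cont_value_integrable[OF n last_index(1) \<mu> order_refl] bound_integrable[OF order_refl]])
    show "AE \<omega> in M. cont_value n (n - 1) \<mu> 0 \<omega> \<le> MY 0 \<omega>"
      using continuation_abs_le[OF Vbar_dominated[OF n last_index(1) \<mu>] maturity[OF n last_index(1)] order_refl]
      by eventually_elim simp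
  qed
qed

lemma V_eq_algorithm_value:
  assumes triv: "trivial_at_0 M F" and \<nu>: "\<nu> \<in> Adm"
  shows "AE \<omega> in M. V n n \<nu> 0 \<omega> = algorithm_value n"
proof -
  let ?c = "\<lambda>\<mu>. \<integral>\<omega>. cont_value n (n - 1) \<mu> 0 \<omega> \<partial>M"
  have S: "is_ess_sup M ((\<lambda>\<mu>. cont_value n (n - 1) \<mu> 0) ` Adm) (V n n \<nu> 0)"
    using is_ess_sup_V[OF n \<nu> last_index(1) order_refl] unfolding admissible_from_0 last_index(2) .
  have const: "AE \<omega> in M. cont_value n (n - 1) \<mu> 0 \<omega> = ?c \<mu>" if "\<mu> \<in> Adm" for \<mu>
    by (rule AE_eq_expectation_of_trivial[OF triv continuation_measurable
          cont_value_integrable[OF n last_index(1) that order_refl]])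
  have "AE \<omega> in M. V n n \<nu> 0 \<omega> \<le> algorithm_value n"
  proof (rule is_ess_sup_least[OF S])
    fix X assume "X \<in> (\<lambda>\<mu>. cont_value n (n - 1) \<mu> 0) ` Adm"
    then obtain \<mu> where \<mu>: "\<mu> \<in> Adm" and X: "X = cont_value n (n - 1) \<mu> 0" by blast
    have "?c \<mu> \<le> algorithm_value n"
      unfolding algorithm_value_def by (rule cSUP_upper[OF \<mu> bdd_above_cont_values])
    with const[OF \<mu>] show "AE \<omega> in M. X \<omega> \<le> algorithm_value n"
      unfolding X by (elim eventually_mono) linarith
  qed simp
  moreover have "AE \<omega> in M. \<forall>j. algorithm_value n - 1 / Suc j \<le> V n n \<nu> 0 \<omega>"
    unfolding AE_all_countable
  proof
    fix j
    have ne: "Adm \<noteq> {}" using \<nu> by blast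
    have "algorithm_value n - 1 / Suc j < algorithm_value n" by simp
    then obtain \<mu> where \<mu>: "\<mu> \<in> Adm" "algorithm_value n - 1 / Suc j < ?c \<mu>"
      unfolding algorithm_value_def less_cSUP_iff[OF ne bdd_above_cont_values] by blast
    have "AE \<omega> in M. cont_value n (n - 1) \<mu> 0 \<omega> \<le> V n n \<nu> 0 \<omega>"
      by (rule is_ess_sup_upper[OF S imageI[OF \<mu>(1)]])
    then show "AE \<omega> in M. algorithm_value n - 1 / Suc j \<le> V n n \<nu> 0 \<omega>"
      using const[OF \<mu>(1)] by eventually_elim (use \<mu>(2) in linarith)
  qed
  ultimately show ?thesis
  proof eventually_elim
    case (elim \<omega>)
    have "algorithm_value n \<le> V n n \<nu> 0 \<omega>"
    proof (rule field_le_epsilon)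
      fix e :: real assume "0 < e"
      then obtain j where "1 / Suc j < e" by (rule nat_approx_posE)
      then show "algorithm_value n \<le> V n n \<nu> 0 \<omega> + e" using elim(2)[rule_format, of j] by linarith
    qed
    with elim(1) show ?case by simp
  qed
qed

lemma algorithm_value_le:
  assumes resp: "state_respects_pasting M F Adm Y" and ne: "Adm \<noteq> {}"
    and h: "h \<in> borel_measurable borel" "\<And>x. \<bar>h x\<bar> \<le> C"
    and le: "\<And>\<nu> u. \<nu> \<in> Adm \<Longrightarrow> 0 \<le> u \<Longrightarrow> (\<integral>\<omega>. Y \<nu> u \<omega> \<partial>M) \<le> h u"
  shows "algorithm_value n \<le> (\<integral>\<omega>. h (total_maturity \<zeta> n \<omega>) \<partial>M)"
  unfolding algorithm_value_def
proof (rule cSUP_least[OF ne])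
  fix \<mu> assume \<mu>: "\<mu> \<in> Adm"
  show "(\<integral>\<omega>. cont_value n (n - 1) \<mu> 0 \<omega> \<partial>M) \<le> (\<integral>\<omega>. h (total_maturity \<zeta> n \<omega>) \<partial>M)"
    using cont_value_integral_le[OF last_index(1) \<mu> order_refl h
        Vbar_integral_le_tail[OF resp h le last_index(1) \<mu>]]
    unfolding last_index(2) tail_maturity_all by simp
qed

lemma algorithm_value_ge:
  assumes \<phi>: "\<phi> \<in> borel_measurable borel" "\<And>x. \<bar>\<phi> x\<bar> \<le> C"
    and \<mu>: "\<mu> \<in> Adm" and ge: "\<And>u. 0 \<le> u \<Longrightarrow> \<phi> u \<le> (\<integral>\<omega>. Y \<mu> u \<omega> \<partial>M)"
  shows "(\<integral>\<omega>. \<phi> (total_maturity \<zeta> n \<omega>) \<partial>M) \<le> algorithm_value n"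
proof -
  have "(\<integral>\<omega>. \<phi> (total_maturity \<zeta> n \<omega>) \<partial>M) \<le> (\<integral>\<omega>. cont_value n (n - 1) \<mu> 0 \<omega> \<partial>M)"
    using cont_value_integral_ge[OF last_index(1) \<mu> order_refl \<phi>
        Vbar_integral_ge_tail[OF \<phi> \<mu> ge last_index(1)]]
    unfolding last_index(2) tail_maturity_all by simp
  also have "\<dots> \<le> algorithm_value n"
    unfolding algorithm_value_def by (rule cSUP_upper[OF \<mu> bdd_above_cont_values])
  finally show ?thesis .
qed

end

section \<open>Limits at the terminal maturity\<close>

text \<open>
  Extended to negative times by its value at 0, the mean becomes a function on the whole line that is
  bounded and Borel for every admissible control.
\<close>

definition clamped_mean :: "('a, 'd) control \<Rightarrow> real \<Rightarrow> real" where
  "clamped_mean \<nu> t = (\<integral>\<omega>. Y \<nu> (max 0 t) \<omega> \<partial>M)"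

lemma clamped_mean_nonneg: "0 \<le> t \<Longrightarrow> clamped_mean \<nu> t = (\<integral>\<omega>. Y \<nu> t \<omega> \<partial>M)"
  by (simp add: clamped_mean_def)

lemma clamped_mean_bound: "\<nu> \<in> Adm \<Longrightarrow> \<bar>clamped_mean \<nu> t\<bar> \<le> (\<integral>\<omega>. MY 0 \<omega> \<partial>M)"
  unfolding clamped_mean_def by (rule dominated_integral_bound[OF state_dominated]) auto

lemma clamped_mean_measurable:
  assumes "\<nu> \<in> Adm"
  shows "clamped_mean \<nu> \<in> borel_measurable borel"
proof -
  have "space M \<in> sets (F_infinity M F)" using sets.top[of "F_infinity M F"] by simp
  from section_integral_measurable[OF state_dominated[OF assms] this, of 0]
  have "(\<lambda>t. \<integral>\<omega>. indicator (space M) \<omega> * Y \<nu> (max 0 t) \<omega> \<partial>M) \<in> borel_measurable borel" by simp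
  moreover have "(\<lambda>t. \<integral>\<omega>. indicator (space M) \<omega> * Y \<nu> (max 0 t) \<omega> \<partial>M) = clamped_mean \<nu>"
    unfolding clamped_mean_def by (intro ext Bochner_Integration.integral_cong) auto
  ultimately show ?thesis by simp
qed

lemma clamped_mean_isCont:
  assumes "continuous (at T within {0<..}) (\<lambda>t. \<integral>\<omega>. Y \<nu> t \<omega> \<partial>M)" and T: "0 < T"
  shows "isCont (clamped_mean \<nu>) T"
proof -
  have "isCont (\<lambda>t. \<integral>\<omega>. Y \<nu> t \<omega> \<partial>M) T"
    using assms by (simp add: at_within_open[of T "{0<..}"])
  moreover have "eventually (\<lambda>t. t \<in> {0<..}) (nhds T)" using T by (intro eventually_nhds_in_open) auto
  then have "eventually (\<lambda>t. clamped_mean \<nu> t = (\<integral>\<omega>. Y \<nu> t \<omega> \<partial>M)) (nhds T)"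
    by eventually_elim (simp add: clamped_mean_def)
  ultimately show ?thesis by (simp add: isCont_cong)
qed

text \<open>
  For an empty set of controls the supremum is some fixed real number, so a bound exists in that case
  too.
\<close>

lemma sup_mean_bounded: "\<exists>C. \<forall>t\<ge>0. \<bar>SUP \<nu>\<in>Adm. \<integral>\<omega>. Y \<nu> t \<omega> \<partial>M\<bar> \<le> C"
proof (cases "Adm = {}")
  case False
  have "\<bar>SUP \<nu>\<in>Adm. \<integral>\<omega>. Y \<nu> t \<omega> \<partial>M\<bar> \<le> (\<integral>\<omega>. MY 0 \<omega> \<partial>M)" if "0 \<le> t" for t
    by (rule cSup_abs_le) (use False dominated_integral_bound[OF state_dominated that] in auto)
  then show ?thesis by blast
qed auto

lemma mean_le_sup_mean:
  assumes "\<nu> \<in> Adm" "0 \<le> t"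
  shows "(\<integral>\<omega>. Y \<nu> t \<omega> \<partial>M) \<le> (SUP \<nu>\<in>Adm. \<integral>\<omega>. Y \<nu> t \<omega> \<partial>M)"
proof (rule cSUP_upper[OF assms(1)])
  show "bdd_above ((\<lambda>\<nu>. \<integral>\<omega>. Y \<nu> t \<omega> \<partial>M) ` Adm)"
  proof (rule bdd_aboveI2)
    fix \<mu> assume "\<mu> \<in> Adm"
    from dominated_integral_bound[OF state_dominated[OF this] assms(2)]
    show "(\<integral>\<omega>. Y \<mu> t \<omega> \<partial>M) \<le> (\<integral>\<omega>. MY 0 \<omega> \<partial>M)" by linarith
  qed
qed

text \<open>
  The Borel majorant \<open>h\<close> is a competitor in the infimum that defines the upper integral of the possibly
  non-measurable \<open>g\<close>.
\<close>

lemma upper_integral_maturity_law_le: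
  assumes h: "h \<in> borel_measurable borel" "\<And>x. \<bar>h x\<bar> \<le> C"
    and le: "\<And>t. 0 \<le> t \<Longrightarrow> g t \<le> h t"
  shows "upper_integral (maturity_law M \<zeta> n) (\<lambda>z. g (\<Sum>k=1..n. z k))
    \<le> ereal (\<integral>\<omega>. h (total_maturity \<zeta> n \<omega>) \<partial>M)"
proof -
  let ?P = "\<Pi>\<^sub>M k\<in>{1..n}. (borel :: real measure)"
  let ?X = "\<lambda>\<omega>. \<lambda>k\<in>{1..n}. \<zeta> n k \<omega>"
  let ?H = "\<lambda>z. h (\<Sum>k=1..n. z k)"
  have X: "?X \<in> measurable M ?P"
    by (intro measurable_restrict randomized_maturity_measurable maturities) auto
  have sum: "(\<lambda>z. \<Sum>k=1..n. z k) \<in> borel_measurable ?P" by measurable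
  have H: "?H \<in> borel_measurable ?P" by (rule measurable_compose[OF sum h(1)])
  have sumX: "(\<Sum>k=1..n. ?X \<omega> k) = total_maturity \<zeta> n \<omega>" for \<omega>
    unfolding total_maturity_def by (intro sum.cong) auto
  interpret L: prob_space "maturity_law M \<zeta> n" unfolding maturity_law_def by (rule prob_space_distr[OF X])
  have sets: "sets (maturity_law M \<zeta> n) = sets ?P" by (simp add: maturity_law_def)
  have "integrable (maturity_law M \<zeta> n) ?H"
    by (rule L.integrable_const_bound[of _ C]) (use h(2) H in \<open>auto simp: measurable_cong_sets[OF sets refl]\<close>)
  moreover have "AE z in maturity_law M \<zeta> n. g (\<Sum>k=1..n. z k) \<le> ?H z"
  proof -
    have "AE z in maturity_law M \<zeta> n. 0 \<le> (\<Sum>k=1..n. z k)"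
      unfolding maturity_law_def
    proof (subst AE_distr_iff[OF X])
      show "{z \<in> space ?P. 0 \<le> (\<Sum>k=1..n. z k)} \<in> sets ?P"
        using borel_measurable_le[OF borel_measurable_const sum] by simp
      show "AE \<omega> in M. 0 \<le> (\<Sum>k=1..n. ?X \<omega> k)" unfolding sumX using total_maturity_nonneg by simp
    qed
    then show ?thesis by eventually_elim (rule le)
  qed
  ultimately have "upper_integral (maturity_law M \<zeta> n) (\<lambda>z. g (\<Sum>k=1..n. z k))
      \<le> ereal (\<integral>z. ?H z \<partial>maturity_law M \<zeta> n)"
    unfolding upper_integral_def by (intro INF_lower) simp
  also have "(\<integral>z. ?H z \<partial>maturity_law M \<zeta> n) = (\<integral>\<omega>. h (total_maturity \<zeta> n \<omega>) \<partial>M)"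
    unfolding maturity_law_def integral_distr[OF X H] sumX ..
  finally show ?thesis .
qed

context
  fixes T :: real
  assumes T: "0 < T" and conv: "converges_in_probability M (total_maturity \<zeta>) T"
begin

lemma mean_at_maturity_tendsto:
  assumes \<nu>: "\<nu> \<in> Adm" and cont: "continuous (at T within {0<..}) (\<lambda>t. \<integral>\<omega>. Y \<nu> t \<omega> \<partial>M)"
  shows "(\<lambda>n. \<integral>\<omega>. clamped_mean \<nu> (total_maturity \<zeta> n \<omega>) \<partial>M) \<longlonglongrightarrow> (\<integral>\<omega>. Y \<nu> T \<omega> \<partial>M)"
  using integral_tendsto_of_converges_in_probability[OF total_maturity_measurable conv
      clamped_mean_measurable[OF \<nu>] clamped_mean_bound[OF \<nu>] clamped_mean_isCont[OF cont T]]
    clamped_mean_nonneg[of T \<nu>] T by simp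

text \<open>
  Since the total maturity is itself independent of \<open>F\<^sub>\<infinity>\<close>, freezing it turns the expectation into
  that of the mean of \<open>Y\<close> evaluated at the total maturity, which converges.
\<close>

lemma liminf_expectation_at_maturity:
  assumes ind: "\<And>n. 1 \<le> n \<Longrightarrow> total_maturity \<zeta> n \<in> randomized_maturities M F"
    and \<nu>: "\<nu> \<in> Adm" and cont: "continuous (at T within {0<..}) (\<lambda>t. \<integral>\<omega>. Y \<nu> t \<omega> \<partial>M)"
  shows "ereal (\<integral>\<omega>. Y \<nu> T \<omega> \<partial>M) \<le> liminf (\<lambda>n. ereal (\<integral>\<omega>. Y \<nu> (total_maturity \<zeta> n \<omega>) \<omega> \<partial>M))"
proof -
  have "(\<integral>\<omega>. clamped_mean \<nu> (total_maturity \<zeta> n \<omega>) \<partial>M) = (\<integral>\<omega>. Y \<nu> (total_maturity \<zeta> n \<omega>) \<omega> \<partial>M)"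
    if n: "1 \<le> n" for n
  proof -
    have "(\<integral>\<omega>. Y \<nu> (total_maturity \<zeta> n \<omega>) \<omega> \<partial>M)
        = (\<integral>\<omega>'. \<integral>\<omega>. Y \<nu> (total_maturity \<zeta> n \<omega>') \<omega> \<partial>M \<partial>M)"
      using expectation_maturity(3)[OF state_dominated[OF \<nu>] ind[OF n] order_refl] by simp
    also have "\<dots> = (\<integral>\<omega>'. clamped_mean \<nu> (total_maturity \<zeta> n \<omega>') \<partial>M)"
      by (intro Bochner_Integration.integral_cong) (simp_all add: clamped_mean_nonneg total_maturity_nonneg)
    finally show ?thesis by simp
  qed
  then have "eventually (\<lambda>n. (\<integral>\<omega>. clamped_mean \<nu> (total_maturity \<zeta> n \<omega>) \<partial>M)
      = (\<integral>\<omega>. Y \<nu> (total_maturity \<zeta> n \<omega>) \<omega> \<partial>M)) sequentially"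
    by (intro eventually_sequentiallyI[of 1])
  with mean_at_maturity_tendsto[OF \<nu> cont]
  have "(\<lambda>n. \<integral>\<omega>. Y \<nu> (total_maturity \<zeta> n \<omega>) \<omega> \<partial>M) \<longlonglongrightarrow> (\<integral>\<omega>. Y \<nu> T \<omega> \<partial>M)"
    by (rule Lim_transform_eventually)
  then have "(\<lambda>n. ereal (\<integral>\<omega>. Y \<nu> (total_maturity \<zeta> n \<omega>) \<omega> \<partial>M)) \<longlonglongrightarrow> ereal (\<integral>\<omega>. Y \<nu> T \<omega> \<partial>M)"
    by (rule tendsto_ereal)
  from lim_imp_Liminf[OF _ this] show ?thesis by simp
qed

context
  assumes sup_cont: "continuous (at T within {0<..}) (\<lambda>t. SUP \<nu>\<in>Adm. \<integral>\<omega>. Y \<nu> t \<omega> \<partial>M)"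
begin

lemma exists_sup_mean_majorant:
  assumes "(SUP \<nu>\<in>Adm. \<integral>\<omega>. Y \<nu> T \<omega> \<partial>M) < m"
  obtains h C where "h \<in> borel_measurable borel" "\<And>x. \<bar>h x\<bar> \<le> C"
    "\<And>t. 0 \<le> t \<Longrightarrow> (SUP \<nu>\<in>Adm. \<integral>\<omega>. Y \<nu> t \<omega> \<partial>M) \<le> h t"
    "(\<lambda>n. \<integral>\<omega>. h (total_maturity \<zeta> n \<omega>) \<partial>M) \<longlonglongrightarrow> m"
proof -
  obtain B where B: "\<And>t. 0 \<le> t \<Longrightarrow> \<bar>SUP \<nu>\<in>Adm. \<integral>\<omega>. Y \<nu> t \<omega> \<partial>M\<bar> \<le> B"
    using sup_mean_bounded by blast
  obtain h C where h: "h \<in> borel_measurable borel" "\<And>x. \<bar>h x\<bar> \<le> C" "isCont h T" "h T = m"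
    "\<And>t. 0 \<le> t \<Longrightarrow> (SUP \<nu>\<in>Adm. \<integral>\<omega>. Y \<nu> t \<omega> \<partial>M) \<le> h t"
    using exists_step_majorant[OF sup_cont T B assms] by blast
  show thesis
    by (rule that[OF h(1,2,5)])
       (use integral_tendsto_of_converges_in_probability[OF total_maturity_measurable conv h(1-3)] h(4) in simp_all)
qed

lemma limsup_upper_integral_sup_mean:
  "limsup (\<lambda>n. upper_integral (maturity_law M \<zeta> n) (\<lambda>z. SUP \<nu>\<in>Adm. \<integral>\<omega>. Y \<nu> (\<Sum>k=1..n. z k) \<omega> \<partial>M))
    \<le> ereal (SUP \<nu>\<in>Adm. \<integral>\<omega>. Y \<nu> T \<omega> \<partial>M)"
proof (rule ereal_le_epsilon2)
  fix e :: real assume e: "0 < e"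
  let ?L = "SUP \<nu>\<in>Adm. \<integral>\<omega>. Y \<nu> T \<omega> \<partial>M"
  obtain h C where h: "h \<in> borel_measurable borel" "\<And>x. \<bar>h x\<bar> \<le> C"
    "\<And>t. 0 \<le> t \<Longrightarrow> (SUP \<nu>\<in>Adm. \<integral>\<omega>. Y \<nu> t \<omega> \<partial>M) \<le> h t"
    and lim: "(\<lambda>n. \<integral>\<omega>. h (total_maturity \<zeta> n \<omega>) \<partial>M) \<longlonglongrightarrow> ?L + e"
    using exists_sup_mean_majorant[of "?L + e"] e by auto
  have "limsup (\<lambda>n. upper_integral (maturity_law M \<zeta> n) (\<lambda>z. SUP \<nu>\<in>Adm. \<integral>\<omega>. Y \<nu> (\<Sum>k=1..n. z k) \<omega> \<partial>M))
      \<le> limsup (\<lambda>n. ereal (\<integral>\<omega>. h (total_maturity \<zeta> n \<omega>) \<partial>M))"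
    by (intro Limsup_mono always_eventually allI upper_integral_maturity_law_le[OF h])
  also have "\<dots> = ereal (?L + e)" by (rule lim_imp_Limsup[OF _ tendsto_ereal[OF lim]]) simp
  finally show "limsup (\<lambda>n. upper_integral (maturity_law M \<zeta> n) (\<lambda>z. SUP \<nu>\<in>Adm. \<integral>\<omega>. Y \<nu> (\<Sum>k=1..n. z k) \<omega> \<partial>M))
      \<le> ereal ?L + ereal e" by simp
qed

text \<open>
  From below each fixed control gives its own mean at \<open>T\<close>; from above each majorant gives a
  value arbitrarily close to the supremum.
\<close>

lemma algorithm_value_tendsto:
  assumes resp: "state_respects_pasting M F Adm Y" and ne: "Adm \<noteq> {}"
    and cont: "\<And>\<nu>. \<nu> \<in> Adm \<Longrightarrow> continuous (at T within {0<..}) (\<lambda>t. \<integral>\<omega>. Y \<nu> t \<omega> \<partial>M)"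
  shows "algorithm_value \<longlonglongrightarrow> (SUP \<nu>\<in>Adm. \<integral>\<omega>. Y \<nu> T \<omega> \<partial>M)"
proof (rule order_tendstoI)
  let ?L = "SUP \<nu>\<in>Adm. \<integral>\<omega>. Y \<nu> T \<omega> \<partial>M"
  have ev1: "eventually (\<lambda>n::nat. 1 \<le> n) sequentially" by (rule eventually_ge_at_top)
  fix a assume "a < ?L"
  then obtain \<mu> where \<mu>: "\<mu> \<in> Adm" "a < (\<integral>\<omega>. Y \<mu> T \<omega> \<partial>M)"
    using cSUP_least[OF ne, of "\<lambda>\<nu>. \<integral>\<omega>. Y \<nu> T \<omega> \<partial>M" a] by (meson not_le)
  from order_tendstoD(1)[OF mean_at_maturity_tendsto[OF \<mu>(1) cont[OF \<mu>(1)]] \<mu>(2)] ev1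
  show "eventually (\<lambda>n. a < algorithm_value n) sequentially"
  proof eventually_elim
    case (elim n)
    have "(\<integral>\<omega>. clamped_mean \<mu> (total_maturity \<zeta> n \<omega>) \<partial>M) \<le> algorithm_value n"
      by (rule algorithm_value_ge[OF elim(2) clamped_mean_measurable[OF \<mu>(1)] clamped_mean_bound[OF \<mu>(1)] \<mu>(1)])
         (simp add: clamped_mean_nonneg)
    with elim(1) show ?case by linarith
  qed
next
  let ?L = "SUP \<nu>\<in>Adm. \<integral>\<omega>. Y \<nu> T \<omega> \<partial>M"
  have ev1: "eventually (\<lambda>n::nat. 1 \<le> n) sequentially" by (rule eventually_ge_at_top)
  fix a assume "?L < a"
  then obtain m where m: "?L < m" "m < a" using dense by blast
  obtain h C where h: "h \<in> borel_measurable borel" "\<And>x. \<bar>h x\<bar> \<le> C"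
    "\<And>t. 0 \<le> t \<Longrightarrow> (SUP \<nu>\<in>Adm. \<integral>\<omega>. Y \<nu> t \<omega> \<partial>M) \<le> h t"
    and lim: "(\<lambda>n. \<integral>\<omega>. h (total_maturity \<zeta> n \<omega>) \<partial>M) \<longlonglongrightarrow> m"
    using exists_sup_mean_majorant[OF m(1)] by blast
  from order_tendstoD(2)[OF lim m(2)] ev1
  show "eventually (\<lambda>n. algorithm_value n < a) sequentially"
  proof eventually_elim
    case (elim n)
    have "algorithm_value n \<le> (\<integral>\<omega>. h (total_maturity \<zeta> n \<omega>) \<partial>M)"
      by (rule algorithm_value_le[OF elim(2) resp ne h(1,2)])
         (rule order_trans[OF mean_le_sup_mean h(3)])
    with elim(1) show ?case by linarith
  qed
qed

end

end

end

theorem corollary3p1: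
  fixes M :: "'a measure"
    and F :: "real \<Rightarrow> 'a measure"
    and U :: "(real \<Rightarrow> real ^ 'd::finite) set"
    and Adm :: "('a, 'd) control set"
    and Y :: "('a, 'd) control \<Rightarrow> real \<Rightarrow> 'a \<Rightarrow> real"
    and \<zeta> :: "nat \<Rightarrow> nat \<Rightarrow> 'a \<Rightarrow> real"
    and V Vbar :: "nat \<Rightarrow> nat \<Rightarrow> ('a, 'd) control \<Rightarrow> real \<Rightarrow> 'a \<Rightarrow> real"
    and T :: real
  assumes "prob_space M"
    and "filtration (space M) F" and "\<forall>t. subalgebra M (F t)"
    and "usual_conditions M F" and "trivial_at_0 M F"
    and "U \<subseteq> {0..} \<rightarrow>\<^sub>E UNIV"
    and "Adm \<subseteq> controls M F U"
    and "controlled_state M F (controls M F U) Y"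
    and "\<forall>n\<ge>1. \<forall>k\<in>{1..n}. \<zeta> n k \<in> randomized_maturities M F"
    and "\<forall>n\<ge>1. prob_space.indep_vars M (\<lambda>_. borel) (\<zeta> n) {1..n}"
    and "algorithm M F Adm Y \<zeta> V Vbar"
    and "HY M F Adm Y" and "HV M F Adm V Vbar" and "HU M F Adm"
    and "0 < T" and "converges_in_probability M (total_maturity \<zeta>) T"
  shows
    "((\<forall>n\<ge>1. total_maturity \<zeta> n \<in> randomized_maturities M F) \<longrightarrow>
      (\<forall>\<nu>\<in>Adm. continuous (at T within {0<..}) (\<lambda>t. \<integral>\<omega>. Y \<nu> t \<omega> \<partial>M)) \<longrightarrow>
      (\<forall>\<nu>\<in>Adm. ereal (\<integral>\<omega>. Y \<nu> T \<omega> \<partial>M)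
         \<le> liminf (\<lambda>n. ereal (\<integral>\<omega>. Y \<nu> (total_maturity \<zeta> n \<omega>) \<omega> \<partial>M))))
     \<and>
     (continuous (at T within {0<..}) (\<lambda>t. SUP \<nu>\<in>Adm. \<integral>\<omega>. Y \<nu> t \<omega> \<partial>M) \<longrightarrow>
      limsup (\<lambda>n. upper_integral (maturity_law M \<zeta> n)
                    (\<lambda>z. SUP \<nu>\<in>Adm. \<integral>\<omega>. Y \<nu> (\<Sum>k=1..n. z k) \<omega> \<partial>M))
        \<le> ereal (SUP \<nu>\<in>Adm. \<integral>\<omega>. Y \<nu> T \<omega> \<partial>M))
     \<and>
     (state_respects_pasting M F Adm Y \<longrightarrow>
      (\<forall>\<nu>\<in>Adm. continuous (at T within {0<..}) (\<lambda>t. \<integral>\<omega>. Y \<nu> t \<omega> \<partial>M)) \<longrightarrow>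
      continuous (at T within {0<..}) (\<lambda>t. SUP \<nu>\<in>Adm. \<integral>\<omega>. Y \<nu> t \<omega> \<partial>M) \<longrightarrow>
      (\<exists>v. (\<forall>n\<ge>1. \<forall>\<nu>\<in>Adm. AE \<omega> in M. V n n \<nu> 0 \<omega> = v n) \<and>
           v \<longlonglongrightarrow> (SUP \<nu>\<in>Adm. \<integral>\<omega>. Y \<nu> T \<omega> \<partial>M)))"
proof -
  interpret prob_space M by fact
  obtain MY where MY: "martingale_on M F MY" and bound: "\<forall>\<nu>\<in>Adm. AE \<omega> in M. \<forall>t\<ge>0. \<bar>Y \<nu> t \<omega>\<bar> \<le> MY t \<omega>"
    using \<open>HY M F Adm Y\<close> unfolding HY_def by blast
  interpret filtration "space M" F by fact
  interpret maturity_algorithm M F MY Adm Y \<zeta> V Vbar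
  proof unfold_locales
    show "subalgebra M (F t)" for t using assms(3) by simp
    show "martingale_on M F MY" by fact
    show "progressively_measurable F (Y \<nu>)" if "\<nu> \<in> Adm" for \<nu>
      using that \<open>Adm \<subseteq> controls M F U\<close> \<open>controlled_state M F (controls M F U) Y\<close>
      unfolding controlled_state_def by auto
    show "AE \<omega> in M. \<forall>t\<ge>0. \<bar>Y \<nu> t \<omega>\<bar> \<le> MY t \<omega>" if "\<nu> \<in> Adm" for \<nu>
      using bound that by simp
    show "\<zeta> n k \<in> randomized_maturities M F" if "1 \<le> n" "k \<in> {1..n}" for n k
      using assms(9) that by simp
    show "indep_vars (\<lambda>_. borel) (\<zeta> n) {1..n}" if "1 \<le> n" for n
      using assms(10) that by simp
    show "algorithm M F Adm Y \<zeta> V Vbar" "HV M F Adm V Vbar" "HU M F Adm" by fact+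
  qed
  note T = \<open>0 < T\<close> \<open>converges_in_probability M (total_maturity \<zeta>) T\<close>
  show ?thesis
  proof (intro conjI impI ballI)
    fix \<nu> assume "\<forall>n\<ge>1. total_maturity \<zeta> n \<in> randomized_maturities M F"
      and "\<forall>\<nu>\<in>Adm. continuous (at T within {0<..}) (\<lambda>t. \<integral>\<omega>. Y \<nu> t \<omega> \<partial>M)" and "\<nu> \<in> Adm"
    then show "ereal (\<integral>\<omega>. Y \<nu> T \<omega> \<partial>M)
         \<le> liminf (\<lambda>n. ereal (\<integral>\<omega>. Y \<nu> (total_maturity \<zeta> n \<omega>) \<omega> \<partial>M))"
      by (intro liminf_expectation_at_maturity[OF T]) auto
  next
    assume "continuous (at T within {0<..}) (\<lambda>t. SUP \<nu>\<in>Adm. \<integral>\<omega>. Y \<nu> t \<omega> \<partial>M)"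
    then show "limsup (\<lambda>n. upper_integral (maturity_law M \<zeta> n)
                    (\<lambda>z. SUP \<nu>\<in>Adm. \<integral>\<omega>. Y \<nu> (\<Sum>k=1..n. z k) \<omega> \<partial>M))
        \<le> ereal (SUP \<nu>\<in>Adm. \<integral>\<omega>. Y \<nu> T \<omega> \<partial>M)"
      by (rule limsup_upper_integral_sup_mean[OF T])
  next
    assume resp: "state_respects_pasting M F Adm Y"
      and cont: "\<forall>\<nu>\<in>Adm. continuous (at T within {0<..}) (\<lambda>t. \<integral>\<omega>. Y \<nu> t \<omega> \<partial>M)"
      and sup_cont: "continuous (at T within {0<..}) (\<lambda>t. SUP \<nu>\<in>Adm. \<integral>\<omega>. Y \<nu> t \<omega> \<partial>M)"
    show "\<exists>v. (\<forall>n\<ge>1. \<forall>\<nu>\<in>Adm. AE \<omega> in M. V n n \<nu> 0 \<omega> = v n) \<and>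
           v \<longlonglongrightarrow> (SUP \<nu>\<in>Adm. \<integral>\<omega>. Y \<nu> T \<omega> \<partial>M)"
    proof (cases "Adm = {}")
      case True
      \<comment> \<open>Any sequence of constants is a version of the value, so \<open>v\<close> may be constantly the limit.\<close>
      then show ?thesis by auto
    next
      case False
      have "algorithm_value \<longlonglongrightarrow> (SUP \<nu>\<in>Adm. \<integral>\<omega>. Y \<nu> T \<omega> \<partial>M)"
        using cont by (intro algorithm_value_tendsto[OF T sup_cont resp False]) simp
      then show ?thesis
        using V_eq_algorithm_value[OF _ \<open>trivial_at_0 M F\<close>] by (intro exI[of _ algorithm_value]) simp
    qed
  qed
qed

end
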